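(* Let $\mathrm{k}\colon\mathbb{R}\times\mathbb{R}\to\mathbb{R}$ be a one-dimensional radial kernel, $\mathrm{k}(s,t)=f(|s-t|)$, with basis function $f\in L^\infty_{\mathrm{loc}}$, and let $d\ge 2$ be an integer. Then the following holds true. (i) The kernel $K\colon\mathbb{R}^d\times\mathbb{R}^d\to\mathbb{R}$ defined by $$K(x,y)=\mathbb{E}_{\xi\sim\mathcal{U}_{\mathbb{S}^{d-1}}}\big[\mathrm{k}(\langle\xi,x\rangle,\langle\xi,y\rangle)\big]$$ is given by $K(x,y)=F(\|x-y\|)$, where $F=\mathcal{S}_d(f)$. (ii) If $d\ge 4$, then $\mathcal{S}_d(f)$ is differentiable on $(0,\infty)$ for all $f\in L^\infty_{\mathrm{loc}}$. In particular, $\mathcal{S}_d\colon L^\infty_{\mathrm{loc}}\to L^\infty_{\mathrm{loc}}$ is not surjective.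
   Context: $\|\cdot\|$ is the Euclidean norm, $\mathbb{S}^{d-1}$ the unit sphere in $\mathbb{R}^d$, and $\mathcal{U}_{\mathbb{S}^{d-1}}$ the uniform probability distribution on it. $L^\infty_{\mathrm{loc}}$ denotes the set of (measurable) functions $f\colon\mathbb{R}_{\ge 0}\to\mathbb{R}$ such that $f|_{[0,s]}\in L^\infty([0,s])$ for all $s>0$; its elements are treated as functions defined pointwise. The transform $\mathcal{S}_d\colon L^\infty_{\mathrm{loc}}\to L^\infty_{\mathrm{loc}}$ (a generalized Riemann-Liouville fractional integral) is defined by $\mathcal{S}_d(f)=F$ with $$F(s)=\frac{2\,\Gamma(\frac d2)}{\sqrt{\pi}\,\Gamma(\frac{d-1}{2})}\int_0^1 f(ts)\,(1-t^2)^{\frac{d-3}{2}}\,\mathrm{d}t,\qquad s\ge 0 .$$ *)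

theory Defs
  imports "HOL-Probability.Probability"
begin

text \<open>Pointwise-defined, essentially bounded functions: no identification modulo null sets.\<close>

definition L_infinity :: "'a measure \<Rightarrow> ('a \<Rightarrow> real) set" where
  "L_infinity M = {f \<in> borel_measurable M. \<exists>C. AE x in M. \<bar>f x\<bar> \<le> C}"

text \<open>
  A function on \<open>[0, \<infinity>)\<close> is encoded as an \<^term>\<open>extensional {0::real..}\<close> function, so that
  equality of elements of \<open>L_infinity_loc\<close> is pointwise equality on \<open>[0, \<infinity>)\<close>.
  Measurability is Lebesgue measurability.
\<close>

definition L_infinity_loc :: "(real \<Rightarrow> real) set" where
  "L_infinity_loc =
     {f \<in> extensional {0..}. \<forall>s>0. f \<in> L_infinity (lebesgue_on {0..s})}"

text \<open>
  At the endpoint \<open>t = 1\<close> the weight is \<open>0 powr _ = 0\<close>, also for \<open>d = 2\<close> and \<open>d = 3\<close>;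
  this is a null set of the integral.
\<close>

definition S_transform :: "nat \<Rightarrow> (real \<Rightarrow> real) \<Rightarrow> real \<Rightarrow> real" where
  "S_transform d f = (\<lambda>s\<in>{0..}.
     2 * Gamma (real d / 2) / (sqrt pi * Gamma ((real d - 1) / 2)) *
     (\<integral>t. f (t * s) * (1 - t\<^sup>2) powr ((real d - 3) / 2) \<partial>lebesgue_on {0..1}))"

text \<open>
  The normalised surface measure, obtained as the law of \<open>x / \<parallel>x\<parallel>\<close> for \<open>x\<close> uniformly distributed
  in the unit ball (\<^const>\<open>sgn\<close> is \<open>x / \<parallel>x\<parallel>\<close>).
\<close>

definition sphere_borel_prob :: "'a::euclidean_space measure" where
  "sphere_borel_prob =
     restrict_space (distr (uniform_measure lborel (ball 0 1)) borel sgn) (sphere 0 1)"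

text \<open>
  The completion is needed because for a merely Lebesgue measurable \<open>f\<close> the function
  \<open>\<xi> \<mapsto> f \<bar>\<xi> \<bullet> z\<bar>\<close> need not be Borel measurable on the sphere.
\<close>

definition uniform_sphere :: "'a::euclidean_space measure" where
  "uniform_sphere = completion sphere_borel_prob"

lemma space_uniform_sphere: "space uniform_sphere = sphere 0 1"
  by (simp add: uniform_sphere_def sphere_borel_prob_def space_restrict_space)

lemma prob_space_sphere_borel_prob: "prob_space (sphere_borel_prob :: 'a::euclidean_space measure)"
proof -
  let ?U = "uniform_measure lborel (ball (0::'a) 1)"
  have fin: "emeasure lborel (ball (0::'a) 1) \<noteq> \<infinity>"
    using emeasure_lborel_ball_finite[of "0::'a" 1] by simp
  have pos: "emeasure lborel (ball (0::'a) 1) \<noteq> 0"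
  proof
    assume "emeasure lborel (ball (0::'a) 1) = 0"
    then have "emeasure lebesgue (ball (0::'a) 1) = 0" by simp
    then have "negligible (ball (0::'a) 1)"
      by (simp add: negligible_iff_null_sets null_setsI)
    then show False
      by (simp add: open_not_negligible)
  qed
  interpret U: prob_space ?U
    using pos fin by (rule prob_space_uniform_measure)
  interpret D: prob_space "distr ?U borel sgn"
    by (rule U.prob_space_distr) simp
  have "AE x in lborel. x \<noteq> (0::'a)"
    by (rule AE_lborel_singleton)
  then have "AE x in ?U. x \<noteq> 0"
    by (intro AE_uniform_measureI) auto
  then have "AE x in ?U. sgn x \<in> sphere (0::'a) 1"
    by eventually_elim (simp add: norm_sgn)
  then have "AE x in distr ?U borel sgn. x \<in> sphere (0::'a) 1"
    by (subst AE_distr_iff) (auto simp: sphere_def dist_norm)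
  then have "emeasure (distr ?U borel sgn) (sphere 0 1) = 1"
    by (intro D.emeasure_eq_1_AE) auto
  then show ?thesis
    unfolding sphere_borel_prob_def by (intro prob_space_restrict_space) auto
qed

lemma prob_space_uniform_sphere: "prob_space uniform_sphere"
  unfolding uniform_sphere_def
  by (rule prob_space.prob_space_completion[OF prob_space_sphere_borel_prob])

end

theory Submission
  imports Defs
begin

text \<open>
  For a unit vector \<open>e\<close> the law of \<open>\<bar>\<xi> \<bullet> e\<bar>\<close> has density proportional to \<open>(1 - t\<^sup>2)\<close> to the power
  \<open>(d - 3) / 2\<close> on \<open>[0, 1]\<close>: by rotation invariance \<open>e\<close> may be a basis vector, and Fubini reduces
  the ball integral to the coordinate \<open>y\<close> along \<open>e\<close> and the norm \<open>r\<close> of the others; the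
  substitutions \<open>y = r u\<close> and \<open>u = t / sqrt (1 - t\<^sup>2)\<close> give the density up to a constant, which is
  determined by normalisation and a Beta integral. As the law is absolutely continuous, a Lebesgue
  measurable \<open>f\<close> may be replaced by a Borel function, which gives (i).

  For (ii) put \<open>a = (d - 3) / 2\<close>. Up to a constant and the power \<open>-(2a + 1)\<close> of \<open>s\<close>, \<open>S_transform d f s\<close>
  is the integral of \<open>f\<close> against the weight \<open>(s\<^sup>2 - u\<^sup>2) powr a\<close> on \<open>[0, s]\<close>. The difference quotients
  in \<open>s\<close> of this weight are nonnegative, converge pointwise, and their integrals converge to
  the integral of the limit, so they converge in \<open>L\<^sup>1\<close> by Scheffe's lemma. (Dominated convergence
  is not available for \<open>d = 4\<close>, where the derivative of the weight has a singularity at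
  \<open>u = s\<close>, which moves with \<open>s\<close>.) A step function is therefore not in the range.
\<close>

section \<open>Rotation invariance of Lebesgue measure\<close>

lemma lborel_reflect: "distr lborel borel uminus = (lborel :: 'a::euclidean_space measure)"
  using lborel_affine[of "-1::real" "0::'a"] by (simp add: density_1)

lemma nn_integral_lborel_translation:
  fixes a :: "'a::euclidean_space"
  assumes [measurable]: "f \<in> borel_measurable borel"
  shows "(\<integral>\<^sup>+x. f (a + x) \<partial>lborel) = (\<integral>\<^sup>+x. f x \<partial>lborel)"
  by (subst lborel_distr_plus[of a, symmetric]) (simp add: nn_integral_distr)

lemma nn_integral_lborel_reflect:
  assumes [measurable]: "f \<in> borel_measurable borel"
  shows "(\<integral>\<^sup>+x. f (- x) \<partial>lborel) = (\<integral>\<^sup>+x. f (x::'a::euclidean_space) \<partial>lborel)"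
  by (subst (2) lborel_reflect[symmetric]) (simp add: nn_integral_distr)

text \<open>
  The library has this only for index types of class \<open>wellorder\<close>. Here it follows from the
  uniqueness of translation invariant measures: integrate \<open>A x * B (x + T y)\<close> over
  \<open>(x, y)\<close> in both orders, where \<open>B\<close> is the unit ball.
\<close>

lemma distr_lborel_orthogonal_transformation:
  fixes T :: "'a::euclidean_space \<Rightarrow> 'a"
  assumes T: "orthogonal_transformation T"
  shows "distr lborel borel T = lborel"
proof (rule measure_eqI)
  show "sets (distr lborel borel T) = sets (lborel :: 'a measure)" by simp
  fix A assume "A \<in> sets (distr lborel borel T)"
  then have A[measurable]: "A \<in> sets borel" by simp
  have lin: "linear T" using T by (rule orthogonal_transformation_linear)
  have [measurable]: "T \<in> borel_measurable borel"
    using lin by (intro borel_measurable_continuous_onI linear_continuous_on linear_conv_bounded_linear[THEN iffD1])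
  have bij: "bij T" using T by (rule orthogonal_transformation_bij)
  define S where "S = inv T"
  have TS: "T (S y) = y" for y using bij by (simp add: S_def bij_is_surj surj_f_inv_f)
  have nS: "norm (T y) = norm y" for y using T by (simp add: orthogonal_transformation_norm)
  let ?B = "ball (0::'a) 1"
  have [measurable]: "?B \<in> sets borel" by simp
  \<comment> \<open>As \<open>x = T (S x)\<close>, adding \<open>x\<close> after \<open>T\<close>
    amounts to translating \<open>y\<close> by \<open>S x\<close> before it. The ball is invariant
    under \<open>T\<close> because norms are preserved.\<close>
  have shift: "(\<integral>\<^sup>+y. indicator ?B (x + T y) \<partial>lborel) = emeasure lborel ?B" for x
  proof -
    have "(\<integral>\<^sup>+y. indicator ?B (x + T y) \<partial>lborel) = (\<integral>\<^sup>+y. indicator ?B (T (S x + y)) \<partial>lborel)"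
      using lin by (simp add: linear_add TS)
    also have "\<dots> = (\<integral>\<^sup>+y. indicator ?B (T y) \<partial>lborel)"
      by (rule nn_integral_lborel_translation) measurable
    also have "\<dots> = (\<integral>\<^sup>+y. indicator ?B y \<partial>lborel)"
      by (intro nn_integral_cong) (auto simp: indicator_def nS)
    finally show ?thesis by simp
  qed
  have shift': "(\<integral>\<^sup>+y. indicator A (x - T y) \<partial>lborel) = emeasure (distr lborel borel T) A" for x
  proof -
    have "(\<integral>\<^sup>+y. indicator A (x - T y) \<partial>lborel) = (\<integral>\<^sup>+y. indicator A (T (S x + - y)) \<partial>lborel)"
      using lin by (simp add: linear_add linear_diff TS)
    also have "\<dots> = (\<integral>\<^sup>+y. indicator A (T (S x + y)) \<partial>lborel)"
      by (rule nn_integral_lborel_reflect) measurable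
    also have "\<dots> = (\<integral>\<^sup>+y. indicator A (T y) \<partial>lborel)"
      by (rule nn_integral_lborel_translation) measurable
    also have "\<dots> = (\<integral>\<^sup>+y. indicator A y \<partial>distr lborel borel T)"
      by (rule nn_integral_distr[symmetric]) measurable
    also have "\<dots> = emeasure (distr lborel borel T) A"
      by (rule nn_integral_indicator) simp
    finally show ?thesis .
  qed
  have "emeasure lborel A * emeasure lborel ?B
      = (\<integral>\<^sup>+x. (\<integral>\<^sup>+y. indicator A x * indicator ?B (x + T y) \<partial>lborel) \<partial>lborel)"
    by (simp add: nn_integral_cmult shift nn_integral_multc)
  also have "\<dots> = (\<integral>\<^sup>+y. (\<integral>\<^sup>+x. indicator A x * indicator ?B (x + T y) \<partial>lborel) \<partial>lborel)"
    by (intro lborel_pair.Fubini') measurable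
  \<comment> \<open>Translating \<open>x\<close> by \<open>- T y\<close> moves the dependence on
    \<open>y\<close> from the ball to \<open>A\<close>, so that after the second interchange the
    inner integral is the one in \<open>shift'\<close>.\<close>
  also have "\<dots> = (\<integral>\<^sup>+y. (\<integral>\<^sup>+x. indicator A (- T y + x) * indicator ?B x \<partial>lborel) \<partial>lborel)"
  proof (rule nn_integral_cong)
    fix y
    show "(\<integral>\<^sup>+x. indicator A x * indicator ?B (x + T y) \<partial>lborel) =
      (\<integral>\<^sup>+x. indicator A (- T y + x) * indicator ?B x \<partial>lborel)"
      by (subst nn_integral_lborel_translation[of "\<lambda>x. indicator A x * indicator ?B (x + T y)" "- T y", symmetric])
        (auto simp: algebra_simps)
  qed
  also have "\<dots> = (\<integral>\<^sup>+x. (\<integral>\<^sup>+y. indicator A (- T y + x) * indicator ?B x \<partial>lborel) \<partial>lborel)"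
    by (intro lborel_pair.Fubini') measurable
  also have "\<dots> = emeasure (distr lborel borel T) A * emeasure lborel ?B"
    by (simp add: nn_integral_multc shift' nn_integral_cmult)
  finally have eq: "emeasure lborel A * emeasure lborel ?B = emeasure (distr lborel borel T) A * emeasure lborel ?B" .
  have "emeasure lborel ?B \<noteq> 0" "emeasure lborel ?B \<noteq> top"
    by (simp_all add: emeasure_ball less_imp_neq[OF unit_ball_vol_pos, symmetric])
  with eq show "emeasure (distr lborel borel T) A = emeasure lborel A"
    by (metis ennreal_mult_cancel_left mult.commute)
qed

section \<open>The law of an inner product on the sphere\<close>

text \<open>A sublevel set of the norm is a ball, of volume
  \<open>unit_ball_vol (real m) * r ^ m\<close>, and the density is the derivative of this volume.
  The half-lines \<open>{..a}\<close> determine the measure. This integrates out the directions of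
  all coordinates but one.\<close>

lemma distr_PiM_lborel_norm:
  assumes A: "finite A" "A \<noteq> {}"
  defines "m \<equiv> card A"
  shows "distr (PiM A (\<lambda>_. lborel)) borel (\<lambda>x. sqrt (\<Sum>i\<in>A. (x i)\<^sup>2)) =
    density lborel (\<lambda>r. ennreal (real m * unit_ball_vol (real m) * r ^ (m - 1)) * indicator {0..} r)"
    (is "?L = ?R")
proof (rule measure_eqI_generator_eq[where E = "range (\<lambda>a::real. {..a})" and \<Omega> = UNIV
      and A = "\<lambda>n. {..real n}"])
  have m: "m > 0" using A by (simp add: m_def card_gt_0_iff)
  let ?P = "PiM A (\<lambda>_. lborel :: real measure)"
  have L: "emeasure ?L {..r} =
      emeasure ?P ({f. sqrt (\<Sum>i\<in>A. (f i)\<^sup>2) \<le> r} \<inter> space ?P)" for r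
    using A by (subst emeasure_distr) (auto intro!: arg_cong[where f = "emeasure ?P"])
  have pos: "emeasure ?L {..r} = ennreal (unit_ball_vol (real m) * r ^ m)" if "r > 0" for r
    unfolding L using emeasure_cball_aux[OF A(1) that] by (simp add: m_def)
  \<comment> \<open>\<open>pos\<close> requires a positive radius, so here the set is enclosed in
    balls of radius \<open>1 / (n + 1)\<close>; their volumes tend to 0 because
    \<open>m > 0\<close>.\<close>
  have nonpos: "emeasure ?L {..r} = 0" if "r \<le> 0" for r
  proof -
    have lim: "(\<lambda>n. ennreal (unit_ball_vol (real m) * (inverse (real (Suc n))) ^ m)) \<longlonglongrightarrow>
        ennreal (unit_ball_vol (real m) * 0 ^ m)"
      by (intro tendsto_intros LIMSEQ_inverse_real_of_nat)
    have "emeasure ?L {..r} \<le> ennreal (unit_ball_vol (real m) * (inverse (real (Suc n))) ^ m)" for n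
    proof -
      have "r \<le> inverse (real (Suc n))"
        using that by (meson inverse_nonnegative_iff_nonnegative of_nat_0_le_iff order_trans)
      then have "emeasure ?L {..r} \<le> emeasure ?L {..inverse (real (Suc n))}"
        by (intro emeasure_mono) auto
      then show ?thesis by (simp add: pos del: of_nat_Suc)
    qed
    then have "emeasure ?L {..r} \<le> ennreal (unit_ball_vol (real m) * 0 ^ m)"
      by (intro LIMSEQ_le_const[OF lim]) auto
    then show ?thesis using m by (simp add: power_0_left)
  qed
  show "Int_stable (range (\<lambda>a::real. {..a}))"
    by (auto simp: Int_stable_def)
  show "sets ?L = sigma_sets UNIV (range (\<lambda>a::real. {..a}))"
    by (simp add: borel_eq_atMost)
  show "sets ?R = sigma_sets UNIV (range (\<lambda>a::real. {..a}))"
    by (simp add: borel_eq_atMost)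
  show "emeasure ?L X = emeasure ?R X" if X: "X \<in> range (\<lambda>a::real. {..a})" for X
  proof -
    obtain r where X: "X = {..r}" using X by auto
    have R: "emeasure ?R X = (\<integral>\<^sup>+x. ennreal (real m * unit_ball_vol (real m) * x ^ (m - 1)) *
        indicator {0..r} x \<partial>lborel)"
      unfolding X by (subst emeasure_density) (auto intro!: nn_integral_cong simp: indicator_def)
    show ?thesis
    proof (cases "r > 0")
      case True
      have "(\<integral>\<^sup>+x. ennreal (real m * unit_ball_vol (real m) * x ^ (m - 1)) * indicator {0..r} x \<partial>lborel) =
        ennreal (unit_ball_vol (real m) * r ^ m - unit_ball_vol (real m) * 0 ^ m)"
        using True by (intro nn_integral_FTC_Icc)
          (auto intro!: derivative_eq_intros simp: mult_ac)
      then show ?thesis unfolding R unfolding X pos[OF True] using m by (simp add: power_0_left)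
    next
      case False
      \<comment> \<open>For \<open>r = 0\<close> the integral runs over a single point, where the
        integrand is nonzero if \<open>m = 1\<close>; hence equality only almost everywhere.\<close>
      have "(\<integral>\<^sup>+x. ennreal (real m * unit_ball_vol (real m) * x ^ (m - 1)) * indicator {0..r} x \<partial>lborel) =
        (\<integral>\<^sup>+x. 0 \<partial>(lborel :: real measure))"
        by (rule nn_integral_cong_AE, rule AE_mp[OF AE_lborel_singleton[of 0]], rule AE_I2)
          (use False in \<open>auto simp: indicator_def\<close>)
      then show ?thesis unfolding R using nonpos[of r] False by (simp add: X)
    qed
  qed
  show "(\<Union>i. {..real i}) = UNIV" by (auto simp: real_arch_simple)
  show "emeasure ?L {..real i} \<noteq> \<infinity>" for i
    by (cases "i = 0") (simp_all add: pos nonpos)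
qed auto

text \<open>After \<open>y = r u\<close> the argument of \<open>h\<close> becomes
  \<open>\<bar>u\<bar> / sqrt (1 + u\<^sup>2)\<close>, free of \<open>r\<close>. So \<open>h\<close>
  leaves the integral over \<open>r\<close>, and what remains is the integral of a multiple of
  \<open>r ^ m\<close>, with \<open>m = DIM('a) - 1\<close>, up to the radius
  \<open>1 / sqrt (1 + u\<^sup>2)\<close>.\<close>

lemma nn_integral_ball_cos_Basis:
  fixes h :: "real \<Rightarrow> ennreal" and b :: "'a::euclidean_space"
  assumes h[measurable]: "h \<in> borel_measurable borel" and b: "b \<in> Basis" and d: "DIM('a) \<ge> 2"
  shows "(\<integral>\<^sup>+x. h (\<bar>x \<bullet> b\<bar> / norm x) * indicator (ball 0 1) x \<partial>lborel) =
    ennreal (real (DIM('a) - 1) * unit_ball_vol (real (DIM('a) - 1)) / real DIM('a)) *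
    (\<integral>\<^sup>+u. h (\<bar>u\<bar> / sqrt (1 + u\<^sup>2)) * ennreal (inverse (sqrt (1 + u\<^sup>2)) ^ DIM('a)) \<partial>lborel)"
proof -
  interpret product_sigma_finite "\<lambda>_. lborel :: real measure" by standard
  define A where "A = Basis - {b}"
  define m where "m = DIM('a) - 1"
  have A: "finite A" "A \<noteq> {}" "b \<notin> A" "card A = m" "insert b A = Basis"
  proof -
    show "card A = m" "finite A" "b \<notin> A" "insert b A = Basis"
      using b by (auto simp: A_def m_def card_Diff_singleton)
    with d have "card A > 0" by (simp add: m_def)
    then show "A \<noteq> {}" by (auto simp: card_gt_0_iff)
  qed
  have Suc_m: "Suc m = DIM('a)" and m: "m > 0" using d by (auto simp: m_def)
  define k where "k y r = h (\<bar>y\<bar> / sqrt (y\<^sup>2 + r\<^sup>2)) * indicator {..<1} (sqrt (y\<^sup>2 + r\<^sup>2))" for y r :: real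
  have k[measurable]: "(\<lambda>x. k (f x) (g x)) \<in> borel_measurable M"
    if [measurable]: "f \<in> borel_measurable M" "g \<in> borel_measurable M"
    for f g and M :: "'z measure"
    unfolding k_def by measurable
  define w where "w r = ennreal (real m * unit_ball_vol (real m) * r ^ (m - 1)) * indicator {0..} r" for r :: real
  have w[measurable]: "w \<in> borel_measurable borel" unfolding w_def by measurable
  have norm_eq: "norm (\<Sum>i\<in>Basis. f i *\<^sub>R i :: 'a) = sqrt (\<Sum>i\<in>Basis. (f i)\<^sup>2)" for f
    unfolding norm_conv_dist by (subst euclidean_dist_l2) (simp add: L2_set_def)
  have "(\<integral>\<^sup>+x. h (\<bar>x \<bullet> b\<bar> / norm x) * indicator (ball 0 1) x \<partial>lborel) =
      (\<integral>\<^sup>+f. h (\<bar>f b\<bar> / sqrt (\<Sum>i\<in>Basis. (f i)\<^sup>2)) * indicator {..<1} (sqrt (\<Sum>i\<in>(Basis::'a set). (f i)\<^sup>2))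
        \<partial>PiM (Basis::'a set) (\<lambda>_. lborel))"
    using b by (subst lborel_eq, subst nn_integral_distr)
      (auto intro!: nn_integral_cong simp: norm_eq indicator_def)
  also have "\<dots> = (\<integral>\<^sup>+f. h (\<bar>f b\<bar> / sqrt (\<Sum>i\<in>insert b A. (f i)\<^sup>2)) * indicator {..<1} (sqrt (\<Sum>i\<in>insert b A. (f i)\<^sup>2))
        \<partial>PiM (insert b A) (\<lambda>_. lborel))"
    by (simp only: A(5))
  also have "\<dots> = (\<integral>\<^sup>+y. \<integral>\<^sup>+x. k y (sqrt (\<Sum>i\<in>A. (x i)\<^sup>2)) \<partial>PiM A (\<lambda>_. lborel) \<partial>lborel)"
  proof (subst product_nn_integral_insert_rev[OF A(1,3)], measurable, intro nn_integral_cong)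
    fix y :: real and x :: "'a \<Rightarrow> real"
    have "(\<Sum>i\<in>insert b A. ((x(b := y)) i)\<^sup>2) = y\<^sup>2 + (\<Sum>i\<in>A. (x i)\<^sup>2)"
      using A(1,3) by (auto intro!: sum.cong)
    then show "h (\<bar>(x(b := y)) b\<bar> / sqrt (\<Sum>i\<in>insert b A. ((x(b := y)) i)\<^sup>2)) *
        indicator {..<1} (sqrt (\<Sum>i\<in>insert b A. ((x(b := y)) i)\<^sup>2)) = k y (sqrt (\<Sum>i\<in>A. (x i)\<^sup>2))"
      by (simp add: k_def sum_nonneg)
  qed
  also have "\<dots> = (\<integral>\<^sup>+y. \<integral>\<^sup>+r. k y r \<partial>distr (PiM A (\<lambda>_. lborel)) borel (\<lambda>x. sqrt (\<Sum>i\<in>A. (x i)\<^sup>2)) \<partial>lborel)"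
    by (intro nn_integral_cong) (subst nn_integral_distr; measurable)
  also have "\<dots> = (\<integral>\<^sup>+y. \<integral>\<^sup>+r. k y r \<partial>density lborel w \<partial>lborel)"
    unfolding distr_PiM_lborel_norm[OF A(1,2)] w_def A(4) ..
  also have "\<dots> = (\<integral>\<^sup>+y. \<integral>\<^sup>+r. w r * k y r \<partial>lborel \<partial>lborel)"
    by (intro nn_integral_cong) (subst nn_integral_density; measurable)
  also have "\<dots> = (\<integral>\<^sup>+r. \<integral>\<^sup>+y. w r * k y r \<partial>lborel \<partial>lborel)"
    by (intro lborel_pair.Fubini') measurable
  \<comment> \<open>The factor \<open>ennreal r\<close> is the Jacobian. For \<open>r < 0\<close>
    both sides vanish with \<open>w r\<close>, and \<open>r = 0\<close> is a null set.\<close>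
  also have "\<dots> = (\<integral>\<^sup>+r. \<integral>\<^sup>+u. w r * (ennreal r * k (r * u) r) \<partial>lborel \<partial>lborel)"
  proof (rule nn_integral_cong_AE, rule AE_mp[OF AE_lborel_singleton[of 0]], rule AE_I2, rule impI)
    fix r :: real assume "r \<noteq> 0"
    show "(\<integral>\<^sup>+y. w r * k y r \<partial>lborel) = (\<integral>\<^sup>+u. w r * (ennreal r * k (r * u) r) \<partial>lborel)"
    proof (cases "r > 0")
      case True
      then show ?thesis
        by (subst nn_integral_real_affine[where c = r and t = 0])
          (auto simp: nn_integral_cmult ac_simps)
    next
      case False
      with \<open>r \<noteq> 0\<close> have "w r = 0" by (simp add: w_def)
      then show ?thesis by simp
    qed
  qed
  also have "\<dots> = (\<integral>\<^sup>+u. \<integral>\<^sup>+r. w r * (ennreal r * k (r * u) r) \<partial>lborel \<partial>lborel)"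
    by (intro lborel_pair.Fubini') measurable
  also have "\<dots> = (\<integral>\<^sup>+u. ennreal (real m * unit_ball_vol (real m) / real DIM('a)) *
     (h (\<bar>u\<bar> / sqrt (1 + u\<^sup>2)) * ennreal (inverse (sqrt (1 + u\<^sup>2)) ^ DIM('a))) \<partial>lborel)"
  proof (rule nn_integral_cong)
    fix u :: real
    define q where "q = sqrt (1 + u\<^sup>2)"
    have q: "q > 0" by (simp add: q_def add_pos_nonneg)
    \<comment> \<open>The point with coordinate \<open>r * u\<close> along \<open>b\<close> and
      radius \<open>r\<close> in the others has norm \<open>r * q\<close>, so the ball cuts off at
      \<open>r < inverse q\<close>. Passing to the closed interval changes only the point
      \<open>inverse q\<close>.\<close>
    have "(\<integral>\<^sup>+r. w r * (ennreal r * k (r * u) r) \<partial>lborel) =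
       (\<integral>\<^sup>+r. h (\<bar>u\<bar> / q) * (ennreal (real m * unit_ball_vol (real m) * r ^ m) *
          indicator {0..inverse q} r) \<partial>lborel)"
    proof (rule nn_integral_cong_AE, rule AE_mp[OF AE_lborel_singleton[of 0]],
        rule AE_mp[OF AE_lborel_singleton[of "inverse q"]], rule AE_I2, intro impI)
      fix r :: real assume r: "r \<noteq> inverse q" "r \<noteq> 0"
      show "w r * (ennreal r * k (r * u) r) = h (\<bar>u\<bar> / q) * (ennreal (real m * unit_ball_vol (real m) * r ^ m) *
          indicator {0..inverse q} r)"
      proof (cases "r > 0")
        case True
        have "(r * u)\<^sup>2 + r\<^sup>2 = r\<^sup>2 * (1 + u\<^sup>2)" by (simp add: power_mult_distrib algebra_simps)
        then have sq: "sqrt ((r * u)\<^sup>2 + r\<^sup>2) = r * q"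
          using True by (simp add: q_def real_sqrt_mult)
        have quot: "\<bar>r * u\<bar> / (r * q) = \<bar>u\<bar> / q" using True by (simp add: abs_mult)
        have "r * q < 1 \<longleftrightarrow> r < inverse q" using q by (simp add: inverse_eq_divide pos_less_divide_eq)
        with r(1) True have ind: "indicator {..<1} (r * q) = (indicator {0..inverse q} r :: ennreal)"
          by (auto simp: indicator_def)
        have kr: "k (r * u) r = h (\<bar>u\<bar> / q) * indicator {0..inverse q} r"
          unfolding k_def sq quot ind ..
        have "w r * ennreal r = ennreal (real m * unit_ball_vol (real m) * r ^ (m - 1) * r)"
          using True by (simp add: w_def ennreal_mult'')
        also have "real m * unit_ball_vol (real m) * r ^ (m - 1) * r = real m * unit_ball_vol (real m) * r ^ m"
          using power_minus_mult[OF m, of r] by (simp only: mult.assoc)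
        finally have wr: "w r * ennreal r = ennreal (real m * unit_ball_vol (real m) * r ^ m)" .
        have "w r * (ennreal r * k (r * u) r) = (w r * ennreal r) * k (r * u) r"
          by (simp only: mult.assoc)
        also have "\<dots> = h (\<bar>u\<bar> / q) * (ennreal (real m * unit_ball_vol (real m) * r ^ m) *
          indicator {0..inverse q} r)"
          unfolding wr kr by (simp only: ac_simps)
        finally show ?thesis .
      next
        case False
        then show ?thesis using r by (simp add: w_def)
      qed
    qed
    also have "\<dots> = h (\<bar>u\<bar> / q) * (\<integral>\<^sup>+r. ennreal (real m * unit_ball_vol (real m) * r ^ m) *
          indicator {0..inverse q} r \<partial>lborel)"
      by (rule nn_integral_cmult) measurable
    also have "(\<integral>\<^sup>+r. ennreal (real m * unit_ball_vol (real m) * r ^ m) * indicator {0..inverse q} r \<partial>lborel) =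
      ennreal (real m * unit_ball_vol (real m) / real (Suc m) * inverse q ^ Suc m -
        real m * unit_ball_vol (real m) / real (Suc m) * 0 ^ Suc m)"
    proof (rule nn_integral_FTC_Icc)
      have "((\<lambda>r. real m * unit_ball_vol (real m) / real (Suc m) * r ^ Suc m) has_real_derivative
          real m * unit_ball_vol (real m) / real (Suc m) * (real (Suc m) * x ^ (Suc m - Suc 0))) (at x)" for x
        by (intro DERIV_cmult DERIV_pow)
      then show "((\<lambda>r. real m * unit_ball_vol (real m) / real (Suc m) * r ^ Suc m) has_real_derivative
          real m * unit_ball_vol (real m) * x ^ m) (at x)" for x
        by (simp add: mult.assoc del: of_nat_Suc)
    qed (use q in auto)
    also have "real m * unit_ball_vol (real m) / real (Suc m) * inverse q ^ Suc m -
        real m * unit_ball_vol (real m) / real (Suc m) * 0 ^ Suc m =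
      real m * unit_ball_vol (real m) / real (Suc m) * inverse q ^ Suc m"
      by simp
    also have "ennreal \<dots> = ennreal (real m * unit_ball_vol (real m) / real (Suc m)) * ennreal (inverse q ^ Suc m)"
      using q by (intro ennreal_mult) auto
    finally show "(\<integral>\<^sup>+r. w r * (ennreal r * k (r * u) r) \<partial>lborel) =
       ennreal (real m * unit_ball_vol (real m) / real DIM('a)) *
     (h (\<bar>u\<bar> / sqrt (1 + u\<^sup>2)) * ennreal (inverse (sqrt (1 + u\<^sup>2)) ^ DIM('a)))"
      unfolding q_def[symmetric] Suc_m by (simp only: ac_simps)
  qed
  also have "\<dots> = ennreal (real m * unit_ball_vol (real m) / real DIM('a)) *
    (\<integral>\<^sup>+u. h (\<bar>u\<bar> / sqrt (1 + u\<^sup>2)) * ennreal (inverse (sqrt (1 + u\<^sup>2)) ^ DIM('a)) \<partial>lborel)"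
    by (rule nn_integral_cmult) measurable
  finally show ?thesis by (simp only: m_def)
qed

section \<open>The substitution t / sqrt (1 - t^2) and the Beta integral\<close>

text \<open>With \<open>q = sqrt (1 - t\<^sup>2)\<close> the quotient rule gives
  \<open>(q\<^sup>2 + t\<^sup>2) / q ^ 3\<close>, whose numerator is 1.\<close>

lemma has_field_derivative_div_sqrt:
  fixes t :: real
  assumes "\<bar>t\<bar> < 1"
  shows "((\<lambda>t. t / sqrt (1 - t\<^sup>2)) has_real_derivative (1 - t\<^sup>2) powr (- 3 / 2)) (at t)"
proof -
  have pos: "1 - t\<^sup>2 > 0" using assms by (simp add: abs_square_less_1)
  define q where "q = sqrt (1 - t\<^sup>2)"
  have q: "q > 0" "q\<^sup>2 = 1 - t\<^sup>2" using pos by (auto simp: q_def)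
  have "(1 - t\<^sup>2) powr (- 3 / 2) = (q powr 2) powr (- 3 / 2)"
    using q by (simp add: powr_numeral)
  also have "\<dots> = q powr (- 3)" by (simp add: powr_powr)
  also have "\<dots> = 1 / q ^ 3" using q by (simp add: powr_minus_divide powr_numeral)
  finally have eq: "(1 - t\<^sup>2) powr (- 3 / 2) = 1 / q ^ 3" .
  have "((\<lambda>t. t / sqrt (1 - t\<^sup>2)) has_real_derivative
      (1 * q - t * (- (2 * t) / (2 * q))) / (q * q)) (at t)"
    unfolding q_def using pos
    by (auto intro!: derivative_eq_intros simp: field_simps power2_eq_square)
  also have "(1 * q - t * (- (2 * t) / (2 * q))) / (q * q) = (q\<^sup>2 + t\<^sup>2) / q ^ 3"
    using q(1) by (simp add: field_simps power2_eq_square power3_eq_cube)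
  also have "\<dots> = (1 - t\<^sup>2) powr (- 3 / 2)" unfolding eq q(2) by simp
  finally show ?thesis .
qed

text \<open>For \<open>u = t / q\<close> with \<open>q = sqrt (1 - t\<^sup>2)\<close> the integrand
  contributes \<open>q ^ d\<close> and the Jacobian \<open>1 / q ^ 3\<close>, which explains the
  exponent of \<open>1 - t\<^sup>2\<close>. The factor 2 comes from evenness in \<open>u\<close>.
  Since \<open>u\<close> tends to infinity as \<open>t\<close> tends to 1, the substitution is made
  on compact intervals and followed by monotone convergence.\<close>

lemma nn_integral_subst_div_sqrt:
  fixes h :: "real \<Rightarrow> ennreal"
  assumes h[measurable]: "h \<in> borel_measurable borel"
  shows "(\<integral>\<^sup>+u. h (\<bar>u\<bar> / sqrt (1 + u\<^sup>2)) * ennreal (inverse (sqrt (1 + u\<^sup>2)) ^ d) \<partial>lborel) =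
    2 * (\<integral>\<^sup>+t. h t * ennreal ((1 - t\<^sup>2) powr ((real d - 3) / 2)) * indicator {0..1} t \<partial>lborel)"
proof -
  define G where "G u = h (\<bar>u\<bar> / sqrt (1 + u\<^sup>2)) * ennreal (inverse (sqrt (1 + u\<^sup>2)) ^ d)" for u :: real
  define H where "H t = h t * ennreal ((1 - t\<^sup>2) powr ((real d - 3) / 2))" for t :: real
  have [measurable]: "G \<in> borel_measurable borel" unfolding G_def by measurable
  have [measurable]: "H \<in> borel_measurable borel" unfolding H_def by measurable
  define g where "g t = t / sqrt (1 - t\<^sup>2)" for t :: real
  define T where "T n = 1 - inverse (real (Suc n))" for n
  have T: "0 \<le> T n" "T n < 1" for n by (auto simp: T_def field_simps)
  have incT: "incseq T" by (auto simp: incseq_def T_def field_simps)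
  have limT: "T \<longlonglongrightarrow> 1"
    unfolding T_def using tendsto_diff[OF tendsto_const LIMSEQ_inverse_real_of_nat, of 1] by simp
  have step: "(\<integral>\<^sup>+u. G u * indicator {0..g (T n)} u \<partial>lborel) = (\<integral>\<^sup>+t. H t * indicator {0..T n} t \<partial>lborel)" for n
  proof -
    have "(\<integral>\<^sup>+u. G u * indicator {g 0..g (T n)} u \<partial>lborel) =
      (\<integral>\<^sup>+t. G (g t) * ennreal ((1 - t\<^sup>2) powr (- 3 / 2)) * indicator {0..T n} t \<partial>lborel)"
    \<comment> \<open>\<open>T 0 = 0\<close> gives a degenerate interval, to which the substitution
      rule does not apply.\<close>
    proof (cases "n = 0")
      case True
      have "(\<integral>\<^sup>+u. F u * indicator {0..0} u \<partial>lborel) = 0" for F :: "real \<Rightarrow> ennreal"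
        using AE_lborel_singleton[of "0::real"]
        by (subst nn_integral_cong_AE[where v = "\<lambda>_. 0"]) (auto elim!: eventually_mono simp: indicator_def)
      then show ?thesis using True by (simp add: T_def g_def)
    next
      case False
      then have "0 < T n" by (simp add: T_def field_simps)
      have lt: "\<bar>t\<bar> < 1" "1 - t\<^sup>2 \<noteq> 0" if "t \<in> {0..T n}" for t
        using that T[of n] by (auto simp: abs_square_eq_1)
      show ?thesis
        using \<open>0 < T n\<close> lt unfolding g_def
        by (intro nn_integral_substitution_aux has_field_derivative_div_sqrt)
          (auto intro!: continuous_intros)
    qed
    also have "\<dots> = (\<integral>\<^sup>+t. H t * indicator {0..T n} t \<partial>lborel)"
    proof (rule nn_integral_cong)
      fix t :: real
      show "G (g t) * ennreal ((1 - t\<^sup>2) powr (- 3 / 2)) * indicator {0..T n} t = H t * indicator {0..T n} t"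
      proof (cases "t \<in> {0..T n}")
        case True
        then have t: "0 \<le> t" "t < 1" using T[of n] by auto
        then have pos: "1 - t\<^sup>2 > 0" by (simp add: abs_square_less_1)
        define q where "q = sqrt (1 - t\<^sup>2)"
        have q: "q > 0" "q\<^sup>2 = 1 - t\<^sup>2" using pos by (auto simp: q_def)
        have "1 + (t / q)\<^sup>2 = (inverse q)\<^sup>2"
          using q by (simp add: power_divide field_simps)
        then have sq: "sqrt (1 + (g t)\<^sup>2) = inverse q"
          using q by (simp add: g_def q_def[symmetric])
        have "(1 - t\<^sup>2) powr (real d / 2) = (q powr 2) powr (real d / 2)"
          using q by (simp add: powr_numeral)
        also have "\<dots> = q powr (real d)" by (simp only: powr_powr) simp
        also have "\<dots> = q ^ d" using q by (simp add: powr_realpow)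
        finally have "q ^ d * (1 - t\<^sup>2) powr (- 3 / 2) = (1 - t\<^sup>2) powr (real d / 2) * (1 - t\<^sup>2) powr (- 3 / 2)"
          by simp
        also have "\<dots> = (1 - t\<^sup>2) powr ((real d - 3) / 2)"
          by (simp add: powr_add[symmetric] diff_divide_distrib)
        finally have w: "q ^ d * (1 - t\<^sup>2) powr (- 3 / 2) = (1 - t\<^sup>2) powr ((real d - 3) / 2)" .
        have "\<bar>g t\<bar> / sqrt (1 + (g t)\<^sup>2) = t"
          unfolding sq using t q by (simp add: g_def q_def[symmetric])
        then have "G (g t) = h t * ennreal (q ^ d)"
          unfolding G_def sq by simp
        then show ?thesis
          unfolding H_def w[symmetric] using q by (simp add: ennreal_mult mult.assoc)
      qed simp
    qed
    finally show ?thesis by (simp add: g_def)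
  qed
  have gmono: "g s \<le> g t" if "0 \<le> s" "s \<le> t" "t < 1" for s t
    unfolding g_def using that
    by (intro frac_le) (auto simp: abs_square_less_1 power_mono)
  have G_sup: "(\<integral>\<^sup>+u. G u * indicator {0..} u \<partial>lborel) = (SUP n. \<integral>\<^sup>+u. G u * indicator {0..g (T n)} u \<partial>lborel)"
  proof (subst nn_integral_monotone_convergence_SUP[symmetric])
    show "incseq (\<lambda>n u. G u * indicator {0..g (T n)} u)"
      using gmono T incT by (auto simp: incseq_def le_fun_def indicator_def intro: order_trans)
    have "(SUP n. G u * indicator {0..g (T n)} u) = G u * indicator {0..} u" for u
    proof (cases "u \<ge> 0")
      case True
      \<comment> \<open>The inverse of \<open>g\<close>: from \<open>t < 1\<close> and
        \<open>g t = u\<close> it follows that the intervals \<open>{0..g (T n)}\<close> exhaust the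
        half-line.\<close>
      define t where "t = u / sqrt (1 + u\<^sup>2)"
      have "u < sqrt (1 + u\<^sup>2)" using True by (intro real_less_rsqrt) auto
      moreover have "0 < sqrt (1 + u\<^sup>2)" by (simp add: add_pos_nonneg)
      ultimately have t: "0 \<le> t" "t < 1" using True by (auto simp: t_def)
      have "1 - t\<^sup>2 = inverse (1 + u\<^sup>2)"
        by (simp add: t_def power_divide field_simps add_nonneg_eq_0_iff)
      then have gt: "g t = u"
        by (simp add: g_def t_def real_sqrt_inverse divide_inverse add_nonneg_eq_0_iff)
      obtain n where "t < T n"
        using order_tendstoD(1)[OF limT t(2)] by (auto dest: eventually_happens)
      then have "u \<le> g (T n)" using gmono[of t "T n"] t T gt by auto
      then show ?thesis using True
        by (intro antisym SUP_least SUP_upper2[of n]) (auto simp: indicator_def)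
    qed (auto simp: indicator_def)
    then show "(\<integral>\<^sup>+u. G u * indicator {0..} u \<partial>lborel) =
        (\<integral>\<^sup>+u. (SUP n. G u * indicator {0..g (T n)} u) \<partial>lborel)" by simp
  qed measurable
  have H_sup: "(\<integral>\<^sup>+t. H t * indicator {0..1} t \<partial>lborel) = (SUP n. \<integral>\<^sup>+t. H t * indicator {0..T n} t \<partial>lborel)"
  proof (subst nn_integral_monotone_convergence_SUP[symmetric])
    show "incseq (\<lambda>n t. H t * indicator {0..T n} t)"
      using incT by (auto simp: incseq_def le_fun_def indicator_def intro: order_trans)
    \<comment> \<open>No \<open>T n\<close> reaches 1, so the intervals miss this endpoint, a null
      set.\<close>
    have H_eq: "H t * indicator {0..1} t = (SUP n. H t * indicator {0..T n} t)" if "t \<noteq> 1" for t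
    proof (cases "t \<in> {0..1}")
      case True
      with that have "t < 1" by auto
      then obtain n where "t < T n"
        using order_tendstoD(1)[OF limT, of t] by (auto dest: eventually_happens)
      then show ?thesis using True
        by (intro antisym[rotated] SUP_least SUP_upper2[of n]) (auto simp: indicator_def)
    next
      case False
      then have "t \<notin> {0..T n}" for n using T[of n] by auto
      then show ?thesis using False by simp
    qed
    show "(\<integral>\<^sup>+t. H t * indicator {0..1} t \<partial>lborel) =
        (\<integral>\<^sup>+t. (SUP n. H t * indicator {0..T n} t) \<partial>lborel)"
      by (rule nn_integral_cong_AE, rule AE_mp[OF AE_lborel_singleton[of 1]], rule AE_I2, rule impI,
          rule H_eq)
  qed measurable
  have refl: "(\<integral>\<^sup>+u. G u * indicator {..0} u \<partial>lborel) = (\<integral>\<^sup>+u. G u * indicator {0..} u \<partial>lborel)"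
    by (subst nn_integral_real_affine[where c = "-1" and t = 0])
      (auto intro!: nn_integral_cong simp: G_def indicator_def)
  have "(\<integral>\<^sup>+u. G u \<partial>lborel) = (\<integral>\<^sup>+u. G u * indicator {..0} u + G u * indicator {0..} u \<partial>lborel)"
    by (rule nn_integral_cong_AE, rule AE_mp[OF AE_lborel_singleton[of 0]], rule AE_I2)
      (auto simp: indicator_def)
  also have "\<dots> = 2 * (\<integral>\<^sup>+u. G u * indicator {0..} u \<partial>lborel)"
    by (subst nn_integral_add) (simp_all add: refl mult_2)
  also have "(\<integral>\<^sup>+u. G u * indicator {0..} u \<partial>lborel) = (\<integral>\<^sup>+t. H t * indicator {0..1} t \<partial>lborel)"
    unfolding G_sup H_sup step ..
  finally show ?thesis unfolding G_def H_def .
qed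

text \<open>Substituting \<open>t = x\<^sup>2\<close> in the Beta integral turns
  \<open>t powr (-1 / 2)\<close> into \<open>1 / x\<close>, which cancels the \<open>x\<close> in
  the Jacobian \<open>2 * x\<close>. The range of \<open>a\<close> includes the exponent -1/2, met
  for \<open>d = 2\<close> and, in the derivative of the weight, for \<open>d = 4\<close>.\<close>

lemma nn_integral_powr_one_minus_square:
  fixes a :: real
  assumes a: "a > -1"
  shows "(\<integral>\<^sup>+t. ennreal ((1 - t\<^sup>2) powr a) * indicator {0..1} t \<partial>lborel) = ennreal (Beta (1 / 2) (a + 1) / 2)"
proof -
  have Beta_pos: "Beta (1 / 2) (a + 1) > 0" using a by (simp add: Beta_def Gamma_real_pos)
  have "((\<lambda>t. t powr (-1 / 2) * (1 - t) powr a) has_integral Beta (1 / 2) (a + 1)) {0..1}"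
    using has_integral_Beta_real[of "1/2" "a + 1"] a by simp
  from nn_integral_has_integral_lebesgue[OF _ this] have
     "ennreal (Beta (1 / 2) (a + 1)) =
        (\<integral>\<^sup>+t. ennreal (t powr (-1 / 2) * (1 - t) powr a * indicator {0^2..1^2} t) \<partial>lborel)"
    by (simp add: mult_ac ennreal_mult' ennreal_indicator)
  also have "\<dots> = (\<integral>\<^sup>+x. ennreal (x\<^sup>2 powr (-1 / 2) * (1 - x\<^sup>2) powr a * (2 * x) * indicator {0..1} x) \<partial>lborel)"
    by (subst nn_integral_substitution[where g = "\<lambda>x. x ^ 2" and g' = "\<lambda>x. 2 * x"])
       (auto intro!: derivative_eq_intros continuous_intros simp: set_borel_measurable_def)
  also have "\<dots> = (\<integral>\<^sup>+x. 2 * (ennreal ((1 - x\<^sup>2) powr a) * indicator {0..1} x) \<partial>lborel)"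
    by (rule nn_integral_cong_AE, rule AE_mp[OF AE_lborel_singleton[of 0]], rule AE_I2)
       (auto simp: indicator_def powr_minus powr_half_sqrt field_split_simps ennreal_mult')
  also have "\<dots> = 2 * (\<integral>\<^sup>+x. ennreal ((1 - x\<^sup>2) powr a) * indicator {0..1} x \<partial>lborel)"
    by (rule nn_integral_cmult) measurable
  finally have eq: "ennreal (Beta (1 / 2) (a + 1)) =
    2 * (\<integral>\<^sup>+x. ennreal ((1 - x\<^sup>2) powr a) * indicator {0..1} x \<partial>lborel)" .
  have "2 * ennreal (Beta (1 / 2) (a + 1) / 2) = ennreal (2 * (Beta (1 / 2) (a + 1) / 2))"
    using Beta_pos by (subst ennreal_mult'') auto
  then have "2 * ennreal (Beta (1 / 2) (a + 1) / 2) =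
    2 * (\<integral>\<^sup>+x. ennreal ((1 - x\<^sup>2) powr a) * indicator {0..1} x \<partial>lborel)"
    using eq by simp
  then show ?thesis by (simp add: ennreal_mult_cancel_left)
qed

section \<open>The law for an arbitrary unit vector\<close>

text \<open>An orthogonal map taking a basis vector to \<open>e\<close> preserves Lebesgue measure,
  norms and inner products, so a basis vector suffices.\<close>

lemma nn_integral_ball_cos:
  fixes h :: "real \<Rightarrow> ennreal" and e :: "real ^ 'n"
  assumes h[measurable]: "h \<in> borel_measurable borel" and e: "norm e = 1" and d: "CARD('n) \<ge> 2"
  shows "(\<integral>\<^sup>+x. h (\<bar>x \<bullet> e\<bar> / norm x) * indicator (ball 0 1) x \<partial>lborel) =
    ennreal (real (CARD('n) - 1) * unit_ball_vol (real (CARD('n) - 1)) / real CARD('n)) *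
    (2 * (\<integral>\<^sup>+t. h t * ennreal ((1 - t\<^sup>2) powr ((real CARD('n) - 3) / 2)) * indicator {0..1} t \<partial>lborel))"
proof -
  obtain i :: 'n where "True" by blast
  define b :: "real ^ 'n" where "b = axis i 1"
  have b: "b \<in> Basis" "norm b = 1" by (auto simp: b_def axis_in_Basis_iff)
  obtain T where T: "orthogonal_transformation T" "T b = e"
    using orthogonal_transformation_exists_1[of b e] b e by metis
  have [measurable]: "T \<in> borel_measurable borel"
    using orthogonal_transformation_linear[OF T(1)]
    by (intro borel_measurable_continuous_onI linear_continuous_on linear_conv_bounded_linear[THEN iffD1])
  have [measurable]: "ball (0 :: real ^ 'n) 1 \<in> sets borel" by simp
  have "T x \<bullet> e = x \<bullet> b" for x
    using T by (metis orthogonal_transformation_def)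
  moreover have "norm (T x) = norm x" for x using T by (simp add: orthogonal_transformation_norm)
  moreover have "(\<integral>\<^sup>+x. h (\<bar>x \<bullet> e\<bar> / norm x) * indicator (ball 0 1) x \<partial>lborel) =
     (\<integral>\<^sup>+x. h (\<bar>T x \<bullet> e\<bar> / norm (T x)) * indicator (ball 0 1) (T x) \<partial>lborel)"
    by (subst distr_lborel_orthogonal_transformation[OF T(1), symmetric])
      (subst nn_integral_distr; measurable)
  ultimately have "(\<integral>\<^sup>+x. h (\<bar>x \<bullet> e\<bar> / norm x) * indicator (ball 0 1) x \<partial>lborel) =
     (\<integral>\<^sup>+x. h (\<bar>x \<bullet> b\<bar> / norm x) * indicator (ball 0 1) x \<partial>lborel)"
    by (simp add: indicator_def)
  then show ?thesis
    using nn_integral_ball_cos_Basis[OF h b(1)] d nn_integral_subst_div_sqrt[OF h, of "CARD('n)"] by simp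
qed

lemma distr_sphere_borel_prob_inner:
  fixes e :: "real ^ 'n"
  assumes e: "norm e = 1" and d: "CARD('n) = d" "d \<ge> 2"
  shows "distr sphere_borel_prob borel (\<lambda>\<xi>. \<bar>\<xi> \<bullet> e\<bar>) =
    density lborel (\<lambda>t. ennreal (2 * Gamma (real d / 2) / (sqrt pi * Gamma ((real d - 1) / 2)) *
      (1 - t\<^sup>2) powr ((real d - 3) / 2)) * indicator {0..1} t)"
proof -
  let ?S = "sphere_borel_prob :: (real ^ 'n) measure"
  let ?B = "ball 0 1 :: (real ^ 'n) set"
  define a where "a = (real d - 3) / 2"
  have a: "a > -1" using d by (simp add: a_def)
  define w where "w t = ennreal ((1 - t\<^sup>2) powr a) * indicator {0..1} t" for t :: real
  have [measurable]: "w \<in> borel_measurable borel" unfolding w_def by measurable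
  define C where "C = ennreal (real (d - 1) * unit_ball_vol (real (d - 1)) / real d) * 2 / emeasure lborel ?B"
  have meas[measurable]: "(\<lambda>\<xi>. \<bar>\<xi> \<bullet> e\<bar>) \<in> borel_measurable ?S"
    unfolding sphere_borel_prob_def by (intro measurable_restrict_space1) measurable
  have S: "(\<integral>\<^sup>+\<xi>. h \<bar>\<xi> \<bullet> e\<bar> \<partial>?S) = C * (\<integral>\<^sup>+t. h t * w t \<partial>lborel)"
    if h[measurable]: "h \<in> borel_measurable borel" for h :: "real \<Rightarrow> ennreal"
  proof -
    have [measurable]: "sphere (0 :: real ^ 'n) 1 \<in> sets borel" by simp
    have "(\<integral>\<^sup>+\<xi>. h \<bar>\<xi> \<bullet> e\<bar> \<partial>?S) =
        (\<integral>\<^sup>+\<xi>. h \<bar>\<xi> \<bullet> e\<bar> * indicator (sphere 0 1) \<xi> \<partial>distr (uniform_measure lborel ?B) borel sgn)"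
      unfolding sphere_borel_prob_def by (subst nn_integral_restrict_space) auto
    also have "\<dots> = (\<integral>\<^sup>+x. h \<bar>sgn x \<bullet> e\<bar> * indicator (sphere 0 1) (sgn x) \<partial>uniform_measure lborel ?B)"
      by (subst nn_integral_distr) auto
    also have "\<dots> = (\<integral>\<^sup>+x. h \<bar>sgn x \<bullet> e\<bar> * indicator (sphere 0 1) (sgn x) * indicator ?B x \<partial>lborel) / emeasure lborel ?B"
      by (subst nn_integral_uniform_measure) auto
    \<comment> \<open>Away from the null point 0, \<open>sgn x\<close> lies on the sphere and
      \<open>sgn x \<bullet> e\<close> is \<open>(x \<bullet> e) / norm x\<close>.\<close>
    also have "(\<integral>\<^sup>+x. h \<bar>sgn x \<bullet> e\<bar> * indicator (sphere 0 1) (sgn x) * indicator ?B x \<partial>lborel) =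
        (\<integral>\<^sup>+x. h (\<bar>x \<bullet> e\<bar> / norm x) * indicator ?B x \<partial>lborel)"
      by (rule nn_integral_cong_AE, rule AE_mp[OF AE_lborel_singleton[of 0]], rule AE_I2)
        (auto simp: sgn_div_norm norm_sgn divide_inverse abs_mult mult.commute)
    also have "\<dots> / emeasure lborel ?B = C * (\<integral>\<^sup>+t. h t * w t \<partial>lborel)"
      using nn_integral_ball_cos[OF h e] d
      by (simp add: C_def w_def a_def ennreal_times_divide ac_simps divide_ennreal_def)
    finally show ?thesis .
  qed
  have Beta_pos: "Beta (1 / 2) (a + 1) > 0" using a by (simp add: Beta_def Gamma_real_pos)
  interpret prob_space ?S by (rule prob_space_sphere_borel_prob)
  \<comment> \<open>Taking \<open>h = 1\<close> in \<open>S\<close> expresses the total mass 1,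
    which determines \<open>C\<close> without evaluating any ball volume.\<close>
  have "C * ennreal (Beta (1 / 2) (a + 1) / 2) = 1"
    using S[of "\<lambda>_. 1"] nn_integral_powr_one_minus_square[OF a] by (simp add: w_def emeasure_space_1)
  moreover have "ennreal (2 / Beta (1 / 2) (a + 1)) * ennreal (Beta (1 / 2) (a + 1) / 2) = 1"
    using Beta_pos by (subst ennreal_mult''[symmetric]) auto
  ultimately have "C = ennreal (2 / Beta (1 / 2) (a + 1))"
    using Beta_pos by (metis ennreal_mult_cancel_left mult.commute ennreal_neq_top mult_zero_right zero_neq_one)
  also have "2 / Beta (1 / 2) (a + 1) = 2 * Gamma (real d / 2) / (sqrt pi * Gamma ((real d - 1) / 2))"
    by (simp add: Beta_def Gamma_one_half_real a_def diff_divide_distrib add_divide_distrib)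
  finally have C: "C = ennreal (2 * Gamma (real d / 2) / (sqrt pi * Gamma ((real d - 1) / 2)))" .
  have cpos: "0 \<le> 2 * Gamma (real d / 2) / (sqrt pi * Gamma ((real d - 1) / 2))"
    using d by (simp add: Gamma_real_nonneg)
  show ?thesis
  proof (rule measure_eqI)
    fix A assume "A \<in> sets (distr ?S borel (\<lambda>\<xi>. \<bar>\<xi> \<bullet> e\<bar>))"
    then have [measurable]: "A \<in> sets borel" by simp
    have "emeasure (distr ?S borel (\<lambda>\<xi>. \<bar>\<xi> \<bullet> e\<bar>)) A =
        (\<integral>\<^sup>+t. indicator A t \<partial>distr ?S borel (\<lambda>\<xi>. \<bar>\<xi> \<bullet> e\<bar>))"
      by (simp add: nn_integral_indicator)
    also have "\<dots> = (\<integral>\<^sup>+\<xi>. indicator A \<bar>\<xi> \<bullet> e\<bar> \<partial>?S)"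
      by (subst nn_integral_distr; measurable)
    also have "\<dots> = C * (\<integral>\<^sup>+t. indicator A t * w t \<partial>lborel)"
      by (rule S) measurable
    also have "\<dots> = (\<integral>\<^sup>+t. C * w t * indicator A t \<partial>lborel)"
      by (subst nn_integral_cmult[symmetric]) (auto simp: ac_simps)
    also have "\<dots> = emeasure (density lborel (\<lambda>t. C * w t)) A"
      by (subst emeasure_density) auto
    also have "(\<lambda>t. C * w t) = (\<lambda>t. ennreal (2 * Gamma (real d / 2) / (sqrt pi * Gamma ((real d - 1) / 2)) *
      (1 - t\<^sup>2) powr ((real d - 3) / 2)) * indicator {0..1} t)"
      unfolding C w_def a_def by (simp only: ennreal_mult[OF cpos powr_ge_zero] mult.assoc)
    finally show "emeasure (distr ?S borel (\<lambda>\<xi>. \<bar>\<xi> \<bullet> e\<bar>)) A =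
      emeasure (density lborel (\<lambda>t. ennreal (2 * Gamma (real d / 2) / (sqrt pi * Gamma ((real d - 1) / 2)) *
      (1 - t\<^sup>2) powr ((real d - 3) / 2)) * indicator {0..1} t)) A" .
  qed simp
qed

section \<open>Expectation of a radial kernel\<close>

text \<open>In the completion every subset of a null set is measurable, so a Borel function may be
  altered on a null set. This serves both completions in play, Lebesgue measure and
  \<open>uniform_sphere\<close>.\<close>

lemma completion_AE_eq:
  fixes f f' :: "'a \<Rightarrow> real"
  assumes f'[measurable]: "f' \<in> borel_measurable M" and ae: "AE x in M. f x = f' x"
  shows "f \<in> borel_measurable (completion M)"
    and "integrable (completion M) f \<longleftrightarrow> integrable M f'"
    and "integral\<^sup>L (completion M) f = integral\<^sup>L M f'"
proof -
  have ae': "AE x in completion M. f x = f' x" using ae by (rule AE_completion)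
  have f'm: "f' \<in> borel_measurable (completion M)" by (intro measurable_completion) measurable
  show fm: "f \<in> borel_measurable (completion M)"
  proof (rule measurableI)
    fix A :: "real set" assume [measurable]: "A \<in> sets borel"
    show "f -` A \<inter> space (completion M) \<in> sets (completion M)"
    proof (rule completion.in_sets_AE)
      show "f' -` A \<inter> space (completion M) \<in> sets (completion M)"
        using f'm by measurable
      show "AE x in completion M. (x \<in> f' -` A \<inter> space (completion M)) = (x \<in> f -` A \<inter> space (completion M))"
        using ae' by eventually_elim auto
    qed auto
  qed simp
  show "integrable (completion M) f \<longleftrightarrow> integrable M f'"
    using integrable_cong_AE[OF fm f'm ae'] integrable_completion[OF f'] by simp
  show "integral\<^sup>L (completion M) f = integral\<^sup>L M f'"
    using integral_cong_AE[OF fm f'm ae'] integral_completion[OF f'] by simp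
qed

text \<open>One pair \<open>g\<close>, \<open>C\<close> serves all \<open>s\<close> up to
  \<open>R\<close>, which is what differentiation in \<open>s\<close> requires. The exceptional set
  is contained in a Borel null set, and the preimage of that set under
  \<open>t \<mapsto> t * s\<close> is null as \<open>s > 0\<close>.\<close>

lemma L_infinity_loc_bounded_borel:
  assumes f: "f \<in> L_infinity_loc" and R: "R > 0"
  obtains g C where "g \<in> borel_measurable borel" "\<And>u. \<bar>g u\<bar> \<le> C"
    "\<And>s. 0 < s \<Longrightarrow> s \<le> R \<Longrightarrow> AE t in lborel. 0 \<le> t \<and> t \<le> 1 \<longrightarrow> f (t * s) = g (t * s)"
proof -
  have fm: "f \<in> borel_measurable (lebesgue_on {0..R})"
    using f R by (auto simp: L_infinity_loc_def L_infinity_def)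
  obtain C where C: "AE u in lebesgue_on {0..R}. \<bar>f u\<bar> \<le> C"
    using f R by (auto simp: L_infinity_loc_def L_infinity_def)
  have "(\<lambda>u. if u \<in> {0..R} then f u else 0) \<in> borel_measurable lebesgue"
    using fm by (subst borel_measurable_if) auto
  then obtain F where F[measurable]: "F \<in> borel_measurable borel"
    and eq: "AE u in lborel. (if u \<in> {0..R} then f u else 0) = F u"
    using completion_ex_borel_measurable_real[of _ "lborel :: real measure"] by auto
  have "AE u in lebesgue. u \<in> {0..R} \<longrightarrow> \<bar>f u\<bar> \<le> C"
    using C by (simp add: AE_restrict_space_iff)
  then have "AE u in lborel. u \<in> {0..R} \<longrightarrow> \<bar>f u\<bar> \<le> C"
    by (simp add: AE_completion_iff)
  with eq have "AE u in lborel. u \<in> {0..R} \<longrightarrow> f u = F u \<and> \<bar>f u\<bar> \<le> C"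
    by eventually_elim auto
  then obtain N where N: "\<And>u. u \<in> space lborel - N \<Longrightarrow> u \<in> {0..R} \<longrightarrow> f u = F u \<and> \<bar>f u\<bar> \<le> C" "N \<in> null_sets lborel"
    by (rule AE_E3) blast
  \<comment> \<open>Truncation makes the bound hold everywhere; on \<open>{0..R}\<close> it alters
    \<open>F\<close> only inside \<open>N\<close>.\<close>
  define g where "g u = (if \<bar>F u\<bar> \<le> C then F u else 0)" for u
  show thesis
  proof (rule that)
    show "g \<in> borel_measurable borel" unfolding g_def by measurable
    \<comment> \<open>\<open>C\<close> may be negative, in which case \<open>g\<close>
      vanishes.\<close>
    show "\<bar>g u\<bar> \<le> \<bar>C\<bar>" for u by (simp add: g_def)
    fix s :: real assume s: "0 < s" "s \<le> R"
    have "N \<in> sets borel" using N(2) by auto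
    moreover have "AE u in lborel. u \<notin> N" using N(2) by (rule AE_not_in)
    ultimately have "AE t in lborel. 0 + s * t \<notin> N"
      using s by (intro AE_borel_affine) auto
    then show "AE t in lborel. 0 \<le> t \<and> t \<le> 1 \<longrightarrow> f (t * s) = g (t * s)"
    proof eventually_elim
      case (elim t)
      show ?case
      proof
        assume "0 \<le> t \<and> t \<le> 1"
        moreover from this s have "t * s \<le> 1 * R" by (intro mult_mono) auto
        ultimately have "t * s \<in> {0..R}" using s by auto
        with elim N(1)[of "t * s"] show "f (t * s) = g (t * s)" by (auto simp: g_def mult.commute)
      qed
    qed
  qed
qed

text \<open>\<open>g\<close> stands for \<open>f (t * s)\<close> as a function of \<open>t\<close>,
  already rescaled, so that \<open>s = 0\<close> is included.\<close>

lemma S_transform_eq_lborel: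
  assumes g[measurable]: "g \<in> borel_measurable borel"
    and ae: "AE t in lborel. 0 \<le> t \<and> t \<le> 1 \<longrightarrow> f (t * s) = g t" and s: "0 \<le> s"
  shows "S_transform d f s = 2 * Gamma (real d / 2) / (sqrt pi * Gamma ((real d - 1) / 2)) *
    (\<integral>t. g t * (1 - t\<^sup>2) powr ((real d - 3) / 2) * indicator {0..1} t \<partial>lborel)"
proof -
  have "(\<integral>t. f (t * s) * (1 - t\<^sup>2) powr ((real d - 3) / 2) \<partial>lebesgue_on {0..1}) =
    (\<integral>t. indicator {0..1} t *\<^sub>R (f (t * s) * (1 - t\<^sup>2) powr ((real d - 3) / 2)) \<partial>lebesgue)"
    by (subst integral_restrict_space) auto
  also have "\<dots> = (\<integral>t. g t * (1 - t\<^sup>2) powr ((real d - 3) / 2) * indicator {0..1} t \<partial>lborel)"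
  proof (rule completion_AE_eq(3))
    show "AE t in lborel. indicator {0..1} t *\<^sub>R (f (t * s) * (1 - t\<^sup>2) powr ((real d - 3) / 2)) =
       g t * (1 - t\<^sup>2) powr ((real d - 3) / 2) * indicator {0..1} t"
      using ae by eventually_elim (auto simp: indicator_def)
  qed measurable
  finally show ?thesis using s by (simp add: S_transform_def)
qed

text \<open>The law of \<open>\<bar>\<xi> \<bullet> e\<bar>\<close> has a density supported on
  \<open>{0..1}\<close>, so the null set of \<open>t\<close> in this interval where
  \<open>f (t * s)\<close> and \<open>g t\<close> differ pulls back to a null set of the sphere. The
  expectation is then that of the bounded Borel function \<open>g\<close>, integrated against the
  density.\<close>

lemma expectation_uniform_sphere_inner:
  fixes e :: "real ^ 'n"
  assumes e: "norm e = 1" and d: "CARD('n) = d" "d \<ge> 2"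
    and g[measurable]: "g \<in> borel_measurable borel" and bound: "\<And>u. \<bar>g u\<bar> \<le> C"
    and ae: "AE t in lborel. 0 \<le> t \<and> t \<le> 1 \<longrightarrow> f (t * s) = g t" and s: "0 \<le> s"
  shows "integrable uniform_sphere (\<lambda>\<xi>. f (\<bar>\<xi> \<bullet> e\<bar> * s))"
    and "prob_space.expectation uniform_sphere (\<lambda>\<xi>. f (\<bar>\<xi> \<bullet> e\<bar> * s)) = S_transform d f s"
proof -
  let ?S = "sphere_borel_prob :: (real ^ 'n) measure"
  define c where "c = 2 * Gamma (real d / 2) / (sqrt pi * Gamma ((real d - 1) / 2))"
  define w where "w t = c * (1 - t\<^sup>2) powr ((real d - 3) / 2) * indicator {0..1} t" for t :: real
  have c: "c \<ge> 0" unfolding c_def using d by (simp add: Gamma_real_nonneg)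
  have [measurable]: "w \<in> borel_measurable borel" unfolding w_def by measurable
  have w: "w t \<ge> 0" for t using c by (simp add: w_def)
  have meas[measurable]: "(\<lambda>\<xi>. \<bar>\<xi> \<bullet> e\<bar>) \<in> borel_measurable ?S"
    unfolding sphere_borel_prob_def by (intro measurable_restrict_space1) measurable
  have distr: "distr ?S borel (\<lambda>\<xi>. \<bar>\<xi> \<bullet> e\<bar>) = density lborel (\<lambda>t. ennreal (w t))"
    unfolding distr_sphere_borel_prob_inner[OF e d] c_def[symmetric] w_def
    by (intro density_cong) (auto simp: indicator_def)
  have "AE t in density lborel (\<lambda>t. ennreal (w t)). f (t * s) = g t"
    using ae by (subst AE_density) (auto simp: w_def indicator_def elim!: eventually_mono split: if_splits)
  then have AE: "AE \<xi> in ?S. f (\<bar>\<xi> \<bullet> e\<bar> * s) = g \<bar>\<xi> \<bullet> e\<bar>"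
    unfolding distr[symmetric] by (rule AE_distrD[OF meas])
  interpret prob_space ?S by (rule prob_space_sphere_borel_prob)
  have "integrable ?S (\<lambda>\<xi>. g \<bar>\<xi> \<bullet> e\<bar>)"
    using bound by (intro integrable_const_bound[where B = C]) auto
  then show "integrable uniform_sphere (\<lambda>\<xi>. f (\<bar>\<xi> \<bullet> e\<bar> * s))"
    unfolding uniform_sphere_def using completion_AE_eq(2)[OF _ AE] by simp
  have "prob_space.expectation uniform_sphere (\<lambda>\<xi>. f (\<bar>\<xi> \<bullet> e\<bar> * s)) = (\<integral>\<xi>. g \<bar>\<xi> \<bullet> e\<bar> \<partial>?S)"
    unfolding uniform_sphere_def by (intro completion_AE_eq(3) AE) measurable
  also have "\<dots> = (\<integral>t. g t \<partial>density lborel (\<lambda>t. ennreal (w t)))"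
    unfolding distr[symmetric] by (intro integral_distr[symmetric]) measurable
  also have "\<dots> = (\<integral>t. w t * g t \<partial>lborel)"
    using w by (subst integral_density) auto
  also have "\<dots> = (\<integral>t. c * (g t * (1 - t\<^sup>2) powr ((real d - 3) / 2) * indicator {0..1} t) \<partial>lborel)"
    by (intro Bochner_Integration.integral_cong) (auto simp: w_def)
  also have "\<dots> = c * (\<integral>t. g t * (1 - t\<^sup>2) powr ((real d - 3) / 2) * indicator {0..1} t \<partial>lborel)"
    by (rule integral_mult_right_zero)
  also have "\<dots> = S_transform d f s"
    unfolding c_def S_transform_eq_lborel[OF g ae s] ..
  finally show "prob_space.expectation uniform_sphere (\<lambda>\<xi>. f (\<bar>\<xi> \<bullet> e\<bar> * s)) = S_transform d f s" .
qed

lemma expectation_uniform_sphere_radial: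
  fixes z :: "real ^ 'n"
  assumes d: "CARD('n) = d" "d \<ge> 2" and f: "f \<in> L_infinity_loc"
  shows "integrable uniform_sphere (\<lambda>\<xi>. f \<bar>\<xi> \<bullet> z\<bar>) \<and>
    prob_space.expectation uniform_sphere (\<lambda>\<xi>. f \<bar>\<xi> \<bullet> z\<bar>) = S_transform d f (norm z)"
proof -
  obtain e :: "real ^ 'n" where e: "norm e = 1" "z = norm z *\<^sub>R e"
  proof (cases "z = 0")
    case True
    obtain i :: 'n where "True" by blast
    show ?thesis using True by (intro that[of "axis i 1"]) auto
  next
    case False
    then show ?thesis by (intro that[of "sgn z"]) (auto simp: norm_sgn sgn_div_norm)
  qed
  have inner: "\<bar>\<xi> \<bullet> z\<bar> = \<bar>\<xi> \<bullet> e\<bar> * norm z" for \<xi>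
    by (subst e(2)) (simp add: abs_mult)
  obtain g C where "g \<in> borel_measurable borel" "\<And>u. \<bar>g u\<bar> \<le> C"
    "AE t in lborel. 0 \<le> t \<and> t \<le> 1 \<longrightarrow> f (t * norm z) = g t"
  proof (cases "z = 0")
    case True
    \<comment> \<open>Only the value \<open>f 0\<close> enters, which a representative modulo null
      sets need not retain; the constant function does.\<close>
    show ?thesis using True by (intro that[of "\<lambda>_. f 0" "\<bar>f 0\<bar>"]) auto
  next
    case False
    then have pos: "norm z > 0" by simp
    obtain g C where g[measurable]: "g \<in> borel_measurable borel" and C: "\<And>u. \<bar>g u\<bar> \<le> C"
      and ae: "\<And>s. 0 < s \<Longrightarrow> s \<le> norm z \<Longrightarrow> AE t in lborel. 0 \<le> t \<and> t \<le> 1 \<longrightarrow> f (t * s) = g (t * s)"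
      by (rule L_infinity_loc_bounded_borel[OF f pos]) blast
    show ?thesis
    proof (rule that)
      show "(\<lambda>t. g (t * norm z)) \<in> borel_measurable borel" by measurable
    qed (use C ae[OF pos] in auto)
  qed
  from expectation_uniform_sphere_inner[OF e(1) d this] show ?thesis
    unfolding inner by simp
qed

section \<open>Differentiability of the transform\<close>

text \<open>The kernel of a fractional integral of Riemann-Liouville type. The indicator is part of
  the weight so that integrals run over a fixed domain and \<open>s\<close> enters through the
  weight only.\<close>

definition RL_weight :: "real \<Rightarrow> real \<Rightarrow> real \<Rightarrow> real" where
  "RL_weight a s u = (s\<^sup>2 - u\<^sup>2) powr a * indicator {0..s} u"

lemma RL_weight_measurable[measurable]: "RL_weight a s \<in> borel_measurable borel"
  unfolding RL_weight_def by measurable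

lemma RL_weight_nonneg[simp]: "RL_weight a s u \<ge> 0"
  by (simp add: RL_weight_def)

text \<open>Both the power and the support grow with \<open>s\<close>. This makes the difference
  quotients in \<open>s\<close> nonnegative.\<close>

lemma RL_weight_mono:
  assumes "s \<le> s'" "a \<ge> 0"
  shows "RL_weight a s u \<le> RL_weight a s' u"
  using assms unfolding RL_weight_def
  by (auto simp: indicator_def intro!: powr_mono2 power_mono)

lemma RL_weight_scale:
  assumes "s > 0"
  shows "RL_weight a s (s * t) = s powr (2 * a) * ((1 - t\<^sup>2) powr a * indicator {0..1} t)"
proof -
  have "s\<^sup>2 - (s * t)\<^sup>2 = s\<^sup>2 * (1 - t\<^sup>2)" by (simp add: algebra_simps power_mult_distrib)
  moreover have "(s\<^sup>2 * (1 - t\<^sup>2)) powr a = s powr (2 * a) * (1 - t\<^sup>2) powr a" if "0 \<le> t" "t \<le> 1"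
  proof -
    have "(s\<^sup>2 * (1 - t\<^sup>2)) powr a = (s\<^sup>2) powr a * (1 - t\<^sup>2) powr a"
      by (rule powr_mult)
    also have "(s\<^sup>2) powr a = (s powr 2) powr a" using assms by (simp add: powr_numeral)
    also have "\<dots> = s powr (2 * a)" by (rule powr_powr)
    finally show ?thesis .
  qed
  ultimately show ?thesis using assms
    by (auto simp: RL_weight_def indicator_def zero_le_mult_iff)
qed

text \<open>The substitution \<open>u = s * t\<close> reduces the integral to a Beta integral over
  [0, 1]; the weight contributes \<open>s powr (2 * a)\<close> and the Jacobian one more power of
  \<open>s\<close>.\<close>

lemma has_bochner_integral_RL_weight:
  assumes s: "s > 0" and a: "a > -1"
  shows "has_bochner_integral lborel (RL_weight a s) (s powr (2 * a + 1) * (Beta (1 / 2) (a + 1) / 2))"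
proof -
  define B where "B = Beta (1 / 2) (a + 1) / 2"
  have B: "B \<ge> 0" using a by (simp add: B_def Beta_def Gamma_real_nonneg)
  have "has_bochner_integral lborel (\<lambda>t::real. (1 - t\<^sup>2) powr a * indicator {0..1} t) B"
  proof (rule has_bochner_integral_nn_integral)
    show "(\<integral>\<^sup>+t. ennreal ((1 - t\<^sup>2) powr a * indicator {0..1} t) \<partial>lborel) = ennreal B"
      using nn_integral_powr_one_minus_square[OF a]
      by (simp add: B_def ennreal_mult' ennreal_indicator)
  qed (use B in auto)
  then have "has_bochner_integral lborel (\<lambda>t. RL_weight a s (0 + s * t)) (s powr (2 * a) * B)"
    using s by (simp add: RL_weight_scale has_bochner_integral_mult_right)
  moreover have "s powr (2 * a) * B = (s powr (2 * a + 1) * B) /\<^sub>R \<bar>s\<bar>"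
    using s by (simp add: powr_add field_simps)
  ultimately have "has_bochner_integral lborel (\<lambda>t. RL_weight a s (0 + s * t)) ((s powr (2 * a + 1) * B) /\<^sub>R \<bar>s\<bar>)"
    by (simp only:)
  then show ?thesis
    using lborel_has_bochner_integral_real_affine_iff[of s "RL_weight a s" "s powr (2 * a + 1) * B" 0] s
    unfolding B_def by blast
qed

text \<open>For \<open>g = 1\<close> the integral is \<open>\<Phi>\<close>, a multiple of a power of
  \<open>s\<close>, and its derivative supplies the convergence of integrals that Scheffe's lemma
  requires. The L1 convergence so obtained survives multiplication by the bounded function
  \<open>g\<close>.\<close>

lemma has_real_derivative_integral_RL_weight:
  assumes g[measurable]: "g \<in> borel_measurable borel" and C: "\<And>u. \<bar>g u\<bar> \<le> C"
    and a: "a > 0" and s: "s > 0"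
  shows "((\<lambda>s. \<integral>u. g u * RL_weight a s u \<partial>lborel) has_real_derivative
    (\<integral>u. g u * (2 * a * s * RL_weight (a - 1) s u) \<partial>lborel)) (at s)"
proof -
  define q where "q u = 2 * a * s * RL_weight (a - 1) s u" for u
  define \<Phi> where "\<Phi> s = integral\<^sup>L lborel (RL_weight a s)" for s
  define b where "b = Beta (1 / 2) (a + 1) / 2"
  have RL_int: "integrable lborel (RL_weight a r)" for r
  proof (cases "r > 0")
    case True
    then show ?thesis using has_bochner_integral_RL_weight[of r a] a by (auto simp: has_bochner_integral_iff)
  next
    case False
    then have "RL_weight a r = (\<lambda>_. 0)" by (auto simp: RL_weight_def indicator_def fun_eq_iff)
    then show ?thesis by simp
  qed
  have \<Phi>: "\<Phi> r = r powr (2 * a + 1) * b" if "r > 0" for r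
    using has_bochner_integral_RL_weight[OF that, of a] a by (simp add: \<Phi>_def b_def has_bochner_integral_iff)
  have q: "integrable lborel q" "integral\<^sup>L lborel q = (2 * a + 1) * s powr (2 * a) * b"
  proof -
    have "has_bochner_integral lborel q (2 * a * s * (s powr (2 * (a - 1) + 1) * (Beta (1 / 2) (a - 1 + 1) / 2)))"
      unfolding q_def using a s by (intro has_bochner_integral_mult_right has_bochner_integral_RL_weight) auto
    \<comment> \<open>The recurrence of \<open>Beta\<close> in its second argument rewrites the
      integral of \<open>q\<close> as the derivative of \<open>\<Phi>\<close> at
      \<open>s\<close>.\<close>
    moreover have "2 * a * s * (s powr (2 * (a - 1) + 1) * (Beta (1 / 2) (a - 1 + 1) / 2)) =
        (2 * a + 1) * s powr (2 * a) * b"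
    proof -
      have "a \<notin> \<int>\<^sub>\<le>\<^sub>0" using a by (auto elim!: nonpos_Ints_cases)
      then have Beta: "(1 / 2 + a) * Beta (1 / 2) (a + 1) = a * Beta (1 / 2) a" by (rule Beta_plus1_right)
      have powr: "s * s powr (2 * (a - 1) + 1) = s powr (2 * a)"
        using s by (simp add: powr_mult_base)
      have "2 * a * s * (s powr (2 * (a - 1) + 1) * (Beta (1 / 2) (a - 1 + 1) / 2)) =
          (a * Beta (1 / 2) a) * (s * s powr (2 * (a - 1) + 1))" by simp
      also have "\<dots> = ((1 / 2 + a) * Beta (1 / 2) (a + 1)) * s powr (2 * a)"
        unfolding Beta powr ..
      also have "\<dots> = (2 * a + 1) * s powr (2 * a) * b"
        by (simp add: b_def algebra_simps)
      finally show ?thesis .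
    qed
    ultimately show "integrable lborel q" "integral\<^sup>L lborel q = (2 * a + 1) * s powr (2 * a) * b"
      by (auto simp: has_bochner_integral_iff)
  qed
  have q_nonneg: "q u \<ge> 0" for u unfolding q_def using a s by simp
  have [measurable]: "q \<in> borel_measurable borel" unfolding q_def by measurable
  have "((\<lambda>r. r powr (2 * a + 1) * b) has_real_derivative (2 * a + 1) * s powr (2 * a) * b) (at s)"
    using s by (auto intro!: derivative_eq_intros)
  then have d\<Phi>: "(\<Phi> has_real_derivative (2 * a + 1) * s powr (2 * a) * b) (at s)"
    by (rule has_field_derivative_transform_within_open[where S = "{0<..}"]) (use s \<Phi> in auto)
  \<comment> \<open>Scheffe's lemma concerns sequences, so the limit of the difference quotient is
    taken along an arbitrary sequence \<open>X\<close> that avoids \<open>s\<close>.\<close>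
  show ?thesis
    unfolding has_field_derivative_iff tendsto_at_iff_sequentially comp_def q_def[symmetric]
  proof (intro allI impI)
    fix X :: "nat \<Rightarrow> real"
    assume ne: "\<forall>i. X i \<in> UNIV - {s}" and X: "X \<longlonglongrightarrow> s"
    define F where "F n u = (RL_weight a (X n) u - RL_weight a s u) / (X n - s)" for n u
    have F_nonneg: "F n u \<ge> 0" for n u
      using RL_weight_mono[of s "X n" a u] RL_weight_mono[of "X n" s a u] a
      by (cases "X n \<le> s") (auto simp: F_def divide_simps)
    have F_int: "integrable lborel (F n)" for n unfolding F_def by (intro integrable_divide Bochner_Integration.integrable_diff RL_int)
    have F_integral: "integral\<^sup>L lborel (F n) = (\<Phi> (X n) - \<Phi> s) / (X n - s)" for n
      unfolding F_def \<Phi>_def by (simp add: RL_int Bochner_Integration.integral_diff)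
    have lim: "(\<lambda>n. integral\<^sup>L lborel (F n)) \<longlonglongrightarrow> integral\<^sup>L lborel q"
      using d\<Phi> ne X unfolding F_integral q(2) has_field_derivative_iff tendsto_at_iff_sequentially comp_def by blast
    \<comment> \<open>At \<open>u = s\<close> the quotients from the right are unbounded if
      \<open>a < 1\<close>. For every other \<open>u\<close> the weight, as a function of its
      parameter near \<open>s\<close>, is either a differentiable power or identically 0.\<close>
    have pointwise: "(\<lambda>n. F n u) \<longlonglongrightarrow> q u" if "u \<noteq> s" for u
    proof (cases "0 \<le> u \<and> u < s")
      case True
      then have "s\<^sup>2 - u\<^sup>2 > 0" by (simp add: power_strict_mono)
      then have deriv: "((\<lambda>r. (r\<^sup>2 - u\<^sup>2) powr a) has_real_derivative q u) (at s)"
        using True by (auto intro!: derivative_eq_intros simp: q_def RL_weight_def)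
      have "((\<lambda>r. RL_weight a r u) has_real_derivative q u) (at s)"
      proof (rule has_field_derivative_transform_within_open[OF deriv])
        show "open {u<..}" "s \<in> {u<..}" using True by auto
        show "(r\<^sup>2 - u\<^sup>2) powr a = RL_weight a r u" if "r \<in> {u<..}" for r
          using that True by (simp add: RL_weight_def)
      qed
      then show ?thesis
        using ne X unfolding has_field_derivative_iff tendsto_at_iff_sequentially comp_def F_def by blast
    next
      case False
      have "eventually (\<lambda>n. F n u = 0) sequentially"
      proof (cases "u < 0")
        case True
        then show ?thesis by (simp add: F_def RL_weight_def)
      next
        case neg: False
        with False that have "s < u" by auto
        from order_tendstoD(2)[OF X this] show ?thesis
          by eventually_elim (use \<open>s < u\<close> in \<open>simp add: F_def RL_weight_def\<close>)
      qed
      moreover have qu: "q u = 0" using False that by (auto simp: q_def RL_weight_def indicator_def)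
      ultimately show ?thesis unfolding qu by (intro tendsto_eventually)
    qed
    have "(\<lambda>n. \<integral>\<^sup>+u. norm (F n u - q u) \<partial>lborel) \<longlonglongrightarrow> 0"
    proof (rule Scheffe_lemma1)
      show "AE u in lborel. (\<lambda>n. F n u) \<longlonglongrightarrow> q u"
        using AE_lborel_singleton[of s] by eventually_elim (rule pointwise)
      have nn: "(\<integral>\<^sup>+u. norm (h u) \<partial>lborel) = ennreal (integral\<^sup>L lborel h)"
        if "integrable lborel h" "\<And>u. h u \<ge> 0" for h :: "real \<Rightarrow> real"
        using that by (simp add: nn_integral_eq_integral)
      have "(\<lambda>n. \<integral>\<^sup>+u. norm (F n u) \<partial>lborel) \<longlonglongrightarrow> (\<integral>\<^sup>+u. norm (q u) \<partial>lborel)"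
        unfolding nn[OF F_int F_nonneg] nn[OF q(1) q_nonneg] by (intro tendsto_ennrealI lim)
      then show "limsup (\<lambda>n. \<integral>\<^sup>+u. norm (F n u) \<partial>lborel) \<le> (\<integral>\<^sup>+u. norm (q u) \<partial>lborel)"
        by (simp add: lim_imp_Limsup)
    qed (use F_int q in auto)
    moreover have "(\<integral>\<^sup>+u. norm (F n u - q u) \<partial>lborel) = ennreal (\<integral>u. norm (F n u - q u) \<partial>lborel)" for n
      using F_int q by (intro nn_integral_eq_integral) auto
    ultimately have L1: "(\<lambda>n. \<integral>u. norm (F n u - q u) \<partial>lborel) \<longlonglongrightarrow> 0"
      by (simp add: tendsto_ennreal_iff[of _ _ 0, simplified])
    have g_int: "integrable lborel (\<lambda>u. g u * h u)" if [measurable]: "integrable lborel h" for h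
    proof (rule Bochner_Integration.integrable_bound)
      show "integrable lborel (\<lambda>u. C * h u)" using that by simp
      have "0 \<le> C" using C[of 0] by linarith
      then show "AE u in lborel. norm (g u * h u) \<le> norm (C * h u)"
        using C by (intro AE_I2) (auto simp: abs_mult intro!: mult_right_mono)
    qed measurable
    have quot: "((\<integral>u. g u * RL_weight a (X n) u \<partial>lborel) - (\<integral>u. g u * RL_weight a s u \<partial>lborel)) / (X n - s) =
       (\<integral>u. g u * F n u \<partial>lborel)" for n
      unfolding F_def times_divide_eq_right right_diff_distrib
      by (simp add: g_int[OF RL_int] Bochner_Integration.integral_diff)
    have "(\<lambda>n. (\<integral>u. g u * F n u \<partial>lborel) - (\<integral>u. g u * q u \<partial>lborel)) \<longlonglongrightarrow> 0"
    proof (rule Lim_null_comparison)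
      have "norm ((\<integral>u. g u * F n u \<partial>lborel) - (\<integral>u. g u * q u \<partial>lborel)) \<le> C * (\<integral>u. norm (F n u - q u) \<partial>lborel)" for n
      proof -
        have "(\<integral>u. g u * F n u \<partial>lborel) - (\<integral>u. g u * q u \<partial>lborel) = (\<integral>u. g u * (F n u - q u) \<partial>lborel)"
          unfolding right_diff_distrib by (intro Bochner_Integration.integral_diff[symmetric] g_int F_int q)
        also have "norm \<dots> \<le> (\<integral>u. norm (g u * (F n u - q u)) \<partial>lborel)"
          by (rule integral_norm_bound)
        also have "\<dots> \<le> (\<integral>u. C * norm (F n u - q u) \<partial>lborel)"
          using C F_int q by (intro integral_mono integrable_norm g_int) (auto simp: abs_mult intro!: mult_right_mono)
        finally show ?thesis by simp
      qed
      then show "\<forall>\<^sub>F n in sequentially. norm ((\<integral>u. g u * F n u \<partial>lborel) - (\<integral>u. g u * q u \<partial>lborel)) \<le> C * (\<integral>u. norm (F n u - q u) \<partial>lborel)"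
        by simp
      show "(\<lambda>n. C * (\<integral>u. norm (F n u - q u) \<partial>lborel)) \<longlonglongrightarrow> 0"
        using tendsto_mult_right_zero[OF L1] .
    qed
    then have "(\<lambda>n. \<integral>u. g u * F n u \<partial>lborel) \<longlonglongrightarrow> (\<integral>u. g u * q u \<partial>lborel)"
      by (simp add: LIM_zero_iff)
    then show "(\<lambda>n. ((\<integral>u. g u * RL_weight a (X n) u \<partial>lborel) - (\<integral>u. g u * RL_weight a s u \<partial>lborel)) / (X n - s))
       \<longlonglongrightarrow> (\<integral>u. g u * q u \<partial>lborel)"
      unfolding quot .
  qed
qed

section \<open>The transform in terms of the weight, and its derivative\<close>

text \<open>The substitution \<open>u = t * s\<close> moves \<open>s\<close> out of the argument of
  \<open>f\<close>, which has no regularity, into the weight. The power of \<open>s\<close> in front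
  compensates the homogeneity of the weight and the Jacobian.\<close>

lemma S_transform_eq_RL_weight:
  fixes d :: nat
  defines "a \<equiv> (real d - 3) / 2"
  assumes g[measurable]: "g \<in> borel_measurable borel"
    and ae: "AE t in lborel. 0 \<le> t \<and> t \<le> 1 \<longrightarrow> f (t * s) = g (t * s)" and s: "s > 0"
  shows "S_transform d f s = 2 * Gamma (real d / 2) / (sqrt pi * Gamma ((real d - 1) / 2)) *
    (s powr - (2 * a + 1) * (\<integral>u. g u * RL_weight a s u \<partial>lborel))"
proof -
  have "(\<integral>u. g u * RL_weight a s u \<partial>lborel) = \<bar>s\<bar> *\<^sub>R (\<integral>t. g (0 + s * t) * RL_weight a s (0 + s * t) \<partial>lborel)"
    using s by (intro lborel_integral_real_affine) auto
  also have "(\<integral>t. g (0 + s * t) * RL_weight a s (0 + s * t) \<partial>lborel) =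
      (\<integral>t. s powr (2 * a) * (g (t * s) * (1 - t\<^sup>2) powr a * indicator {0..1} t) \<partial>lborel)"
    using s by (intro Bochner_Integration.integral_cong) (simp_all add: RL_weight_scale, simp add: ac_simps)
  also have "\<dots> = s powr (2 * a) * (\<integral>t. g (t * s) * (1 - t\<^sup>2) powr a * indicator {0..1} t \<partial>lborel)"
    by (rule integral_mult_right_zero)
  finally have "(\<integral>u. g u * RL_weight a s u \<partial>lborel) =
      s powr (2 * a + 1) * (\<integral>t. g (t * s) * (1 - t\<^sup>2) powr a * indicator {0..1} t \<partial>lborel)"
    using s by (simp add: powr_add)
  then have "s powr - (2 * a + 1) * (\<integral>u. g u * RL_weight a s u \<partial>lborel) =
      (s powr - (2 * a + 1) * s powr (2 * a + 1)) * (\<integral>t. g (t * s) * (1 - t\<^sup>2) powr a * indicator {0..1} t \<partial>lborel)"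
    by simp
  also have "s powr - (2 * a + 1) * s powr (2 * a + 1) = 1"
    using s by (simp flip: powr_add)
  finally show ?thesis
    using S_transform_eq_lborel[of "\<lambda>t. g (t * s)" f s d] ae s by (simp add: a_def)
qed

lemma S_transform_differentiable_on:
  assumes d: "d \<ge> 4" and f: "f \<in> L_infinity_loc"
  shows "S_transform d f differentiable_on {0<..}"
proof (rule differentiable_at_imp_differentiable_on)
  fix s :: real assume "s \<in> {0<..}"
  then have s: "s > 0" by simp
  define a where "a = (real d - 3) / 2"
  have a: "a > 0" using d by (simp add: a_def)
  \<comment> \<open>The bound \<open>2 * s\<close> leaves room, so that a single \<open>g\<close>
    represents \<open>f\<close> for all \<open>r\<close> in a neighbourhood of
    \<open>s\<close>.\<close>
  from s have "2 * s > 0" by simp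
  then obtain g C where g: "g \<in> borel_measurable borel" and C: "\<And>u. \<bar>g u\<bar> \<le> C"
    and ae: "\<And>r. 0 < r \<Longrightarrow> r \<le> 2 * s \<Longrightarrow> AE t in lborel. 0 \<le> t \<and> t \<le> 1 \<longrightarrow> f (t * r) = g (t * r)"
    by (rule L_infinity_loc_bounded_borel[OF f]) blast
  have "\<exists>D. ((\<lambda>r. 2 * Gamma (real d / 2) / (sqrt pi * Gamma ((real d - 1) / 2)) *
    (r powr - (2 * a + 1) * (\<integral>u. g u * RL_weight a r u \<partial>lborel))) has_real_derivative D) (at s)"
    by (rule exI, rule DERIV_cmult, rule DERIV_mult[OF has_real_derivative_powr[OF s]
        has_real_derivative_integral_RL_weight[OF g C a s]])
  then obtain D where D: "((\<lambda>r. 2 * Gamma (real d / 2) / (sqrt pi * Gamma ((real d - 1) / 2)) *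
    (r powr - (2 * a + 1) * (\<integral>u. g u * RL_weight a r u \<partial>lborel))) has_real_derivative D) (at s)" ..
  have "(S_transform d f has_real_derivative D) (at s)"
  proof (rule has_field_derivative_transform_within_open[OF D])
    show "open {0<..<2 * s}" "s \<in> {0<..<2 * s}" using s by auto
    show "2 * Gamma (real d / 2) / (sqrt pi * Gamma ((real d - 1) / 2)) *
      (r powr - (2 * a + 1) * (\<integral>u. g u * RL_weight a r u \<partial>lborel)) = S_transform d f r"
      if "r \<in> {0<..<2 * s}" for r
      unfolding a_def using that by (intro S_transform_eq_RL_weight[symmetric] g ae) auto
  qed
  then show "S_transform d f differentiable at s"
    by (auto simp: real_differentiable_def)
qed

section \<open>The range of the transform\<close>

text \<open>In the form over [0, 1] the weight does not depend on \<open>s\<close>, so the bound of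
  \<open>g\<close> times the total weight works for all \<open>s\<close> at once.\<close>

lemma S_transform_bounded:
  assumes d: "d \<ge> 2" and f: "f \<in> L_infinity_loc" and R: "R > 0"
  shows "\<exists>B. \<forall>s. 0 < s \<and> s \<le> R \<longrightarrow> \<bar>S_transform d f s\<bar> \<le> B"
proof -
  define a where "a = (real d - 3) / 2"
  define c where "c = 2 * Gamma (real d / 2) / (sqrt pi * Gamma ((real d - 1) / 2))"
  have "a > -1" using d by (simp add: a_def)
  then have int: "integrable lborel (RL_weight a 1)"
    using has_bochner_integral_RL_weight[of 1 a] by (simp add: has_bochner_integral_iff)
  obtain g C where g[measurable]: "g \<in> borel_measurable borel" and C: "\<And>u. \<bar>g u\<bar> \<le> C"
    and ae: "\<And>r. 0 < r \<Longrightarrow> r \<le> R \<Longrightarrow> AE t in lborel. 0 \<le> t \<and> t \<le> 1 \<longrightarrow> f (t * r) = g (t * r)"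
    by (rule L_infinity_loc_bounded_borel[OF f R]) blast
  have "\<bar>S_transform d f s\<bar> \<le> \<bar>c\<bar> * (C * integral\<^sup>L lborel (RL_weight a 1))" if s: "0 < s" "s \<le> R" for s
  proof -
    have "S_transform d f s = c * (\<integral>t. g (t * s) * (1 - t\<^sup>2) powr a * indicator {0..1} t \<partial>lborel)"
      using S_transform_eq_lborel[of "\<lambda>t. g (t * s)" f s d] ae[OF s] s by (simp add: a_def c_def)
    also have "\<dots> = c * (\<integral>t. g (t * s) * RL_weight a 1 t \<partial>lborel)"
      by (simp add: RL_weight_def mult.assoc)
    finally have "\<bar>S_transform d f s\<bar> = \<bar>c\<bar> * norm (\<integral>t. g (t * s) * RL_weight a 1 t \<partial>lborel)"
      by (simp add: abs_mult)
    also have "norm (\<integral>t. g (t * s) * RL_weight a 1 t \<partial>lborel) \<le> (\<integral>t. C * RL_weight a 1 t \<partial>lborel)"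
    proof (rule order_trans[OF integral_norm_bound integral_mono])
      have "0 \<le> C" using C[of 0] by linarith
      with C show bound: "norm (g (t * s) * RL_weight a 1 t) \<le> C * RL_weight a 1 t" for t
        by (auto simp: abs_mult intro!: mult_right_mono)
      show C_int: "integrable lborel (\<lambda>t. C * RL_weight a 1 t)" using int by simp
      have "norm (g (t * s) * RL_weight a 1 t) \<le> norm (C * RL_weight a 1 t)" for t
        using order_trans[OF bound abs_ge_self] by simp
      then have "integrable lborel (\<lambda>t. g (t * s) * RL_weight a 1 t)"
        by (intro Bochner_Integration.integrable_bound[OF C_int]) auto
      then show "integrable lborel (\<lambda>t. norm (g (t * s) * RL_weight a 1 t))"
        by (rule integrable_norm)
    qed
    finally show ?thesis by (simp add: mult_left_mono)
  qed
  then show ?thesis by blast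
qed

text \<open>Measurability comes from continuity on the open half-line and the essential bound from
  \<open>S_transform_bounded\<close>. The point 0, which neither covers, is glued on for the former
  and discarded as a null set for the latter.\<close>

lemma S_transform_in_L_infinity_loc:
  assumes d: "d \<ge> 4" and f: "f \<in> L_infinity_loc"
  shows "S_transform d f \<in> L_infinity_loc"
  unfolding L_infinity_loc_def L_infinity_def
proof (intro CollectI conjI allI impI)
  show "S_transform d f \<in> extensional {0..}" by (simp add: S_transform_def)
  fix R :: real assume R: "R > 0"
  have "continuous_on {0<..} (S_transform d f)"
    by (rule differentiable_imp_continuous_on[OF S_transform_differentiable_on[OF d f]])
  then have "(\<lambda>x. if x \<in> {0<..} then S_transform d f x else S_transform d f 0) \<in> borel_measurable borel"
    by (intro borel_measurable_continuous_on_if) auto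
  then have "(\<lambda>x. if x \<in> {0<..} then S_transform d f x else S_transform d f 0) \<in> borel_measurable (lebesgue_on {0..R})"
    by (intro measurable_restrict_space1 measurable_completion) simp
  then show "S_transform d f \<in> borel_measurable (lebesgue_on {0..R})"
    by (rule measurable_cong[THEN iffD1, rotated]) auto
  obtain B where B: "\<And>s. 0 < s \<Longrightarrow> s \<le> R \<Longrightarrow> \<bar>S_transform d f s\<bar> \<le> B"
    using S_transform_bounded[OF _ f R, of d] d by auto
  have "AE s in lebesgue. s \<noteq> (0 :: real)"
    by (intro AE_completion AE_lborel_singleton)
  then have "AE s in lebesgue. s \<in> {0..R} \<longrightarrow> \<bar>S_transform d f s\<bar> \<le> B"
    by eventually_elim (auto intro: B)
  then have "AE s in lebesgue_on {0..R}. \<bar>S_transform d f s\<bar> \<le> B"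
    by (simp add: AE_restrict_space_iff)
  then show "\<exists>C. AE s in lebesgue_on {0..R}. \<bar>S_transform d f s\<bar> \<le> C" ..
qed

lemma S_transform_not_surjective:
  assumes d: "d \<ge> 4"
  shows "S_transform d ` L_infinity_loc \<noteq> L_infinity_loc"
proof
  define h :: "real \<Rightarrow> real" where "h = (\<lambda>s\<in>{0..}. indicator {1..} s)"
  have "h \<in> L_infinity_loc"
    unfolding L_infinity_loc_def L_infinity_def
  proof (intro CollectI conjI allI impI)
    show "h \<in> extensional {0..}" by (simp add: h_def)
    fix R :: real
    have "indicator {1..} \<in> borel_measurable (lebesgue_on {0..R})"
      by (intro measurable_restrict_space1 measurable_completion) measurable
    then show "h \<in> borel_measurable (lebesgue_on {0..R})"
      by (rule measurable_cong[THEN iffD1, rotated]) (auto simp: h_def)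
    show "\<exists>C. AE s in lebesgue_on {0..R}. \<bar>h s\<bar> \<le> C"
      by (intro exI[of _ 1] AE_I2) (auto simp: h_def indicator_def)
  qed
  moreover assume "S_transform d ` L_infinity_loc = L_infinity_loc"
  ultimately obtain g where "g \<in> L_infinity_loc" "h = S_transform d g" by blast
  then have "h differentiable_on {0<..}" using S_transform_differentiable_on[OF d] by simp
  then have "continuous_on {0<..} h" by (rule differentiable_imp_continuous_on)
  then have "isCont h 1" by (simp add: continuous_on_eq_continuous_at)
  \<comment> \<open>For \<open>n = 0\<close> the term is 0, still in the domain of \<open>h\<close>.
    The sequence stays below 1, so \<open>h\<close> is 0 along it while
    \<open>h 1 = 1\<close>.\<close>
  moreover have "(\<lambda>n. 1 - inverse (real (Suc n))) \<longlonglongrightarrow> 1"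
    using tendsto_diff[OF tendsto_const LIMSEQ_inverse_real_of_nat, of 1] by simp
  ultimately have "(\<lambda>n. h (1 - inverse (real (Suc n)))) \<longlonglongrightarrow> h 1"
    by (rule isCont_tendsto_compose)
  moreover have "h (1 - inverse (real (Suc n))) = 0" for n
    by (auto simp: h_def field_simps)
  ultimately show False by (simp add: h_def LIMSEQ_const_iff)
qed

text \<open>Integrability accompanies the formula because the expectation of a non-integrable
  function is 0 by convention. The mapping property and the unequal image together express the
  failure of surjectivity.\<close>

theorem proposition2p2:
  fixes d :: nat
    and f :: "real \<Rightarrow> real"
    and k :: "real \<Rightarrow> real \<Rightarrow> real"
    and K :: "real ^ 'n::finite \<Rightarrow> real ^ 'n \<Rightarrow> real"
  assumes dim: "CARD('n) = d" and d: "d \<ge> 2"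
    and f: "f \<in> L_infinity_loc"
    and k: "\<And>s t. k s t = f \<bar>s - t\<bar>"
    and K: "\<And>x y. K x y =
      prob_space.expectation uniform_sphere (\<lambda>\<xi>. k (\<xi> \<bullet> x) (\<xi> \<bullet> y))"
  shows "(\<forall>x y. integrable (uniform_sphere :: (real ^ 'n) measure) (\<lambda>\<xi>. k (\<xi> \<bullet> x) (\<xi> \<bullet> y)) \<and>
            K x y = S_transform d f (norm (x - y))) \<and>
         (d \<ge> 4 \<longrightarrow>
            (\<forall>g\<in>L_infinity_loc. S_transform d g differentiable_on {0<..}) \<and>
            S_transform d \<in> L_infinity_loc \<rightarrow> L_infinity_loc \<and>
            S_transform d ` L_infinity_loc \<noteq> L_infinity_loc)"
proof -
  have "k (\<xi> \<bullet> x) (\<xi> \<bullet> y) = f \<bar>\<xi> \<bullet> (x - y)\<bar>" for \<xi> x y :: "real ^ 'n"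
    by (simp add: k inner_diff_right)
  then show ?thesis
    using expectation_uniform_sphere_radial[OF dim d f]
      S_transform_differentiable_on S_transform_in_L_infinity_loc S_transform_not_surjective
    by (auto simp: K)
qed

end
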